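(* Let $b$ be a non-constant extreme point of the closed unit ball of $H^\infty$ and let $X_b:\mathcal H(b)\to\mathcal H(b)$, $X_bf=S^*f$. Then for every complex number $\lambda$, the operator $\lambda X_b$ is not hypercyclic.
   Context: $\mathbb D$ is the open unit disc, $\mathbb T=\partial\mathbb D$ with normalized Lebesgue measure, $H^2$ is the Hardy space of $\mathbb D$, and $H^\infty$ is the algebra of bounded analytic functions on $\mathbb D$ with the supremum norm. For $b$ in the closed unit ball of $H^\infty$, the de Branges-Rovnyak space $\mathcal H(b)$ is the Hilbert space of analytic functions on $\mathbb D$ with reproducing kernel $k_\lambda^b(z)=\frac{1-\overline{b(\lambda)}b(z)}{1-\overline{\lambda}z}$, $\lambda,z\in\mathbb D$; it is contractively contained in $H^2$. $b$ is an extreme point of the closed unit ball of $H^\infty$ if and only if $\log(1-|b|)\notin L^1(\mathbb T)$. $S^*=T_{\overline z}$ is the backward shift on $H^2$, $(S^*f)(z)=(f(z)-f(0))/z$; it maps $\mathcal H(b)$ into itself and acts as a contraction there. A bounded operator $T$ on a complex separable Banach space $X$ is hypercyclic if there is $x\in X$ whose orbit $\{T^n x: n\in\mathbb N\}$ is dense in $X$. *)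

theory Defs
  imports "HOL-Complex_Analysis.Complex_Analysis"
begin

text \<open>
  The elements of a function space on \<open>\<Omega>\<close> are represented by total functions that vanish
  outside \<open>\<Omega>\<close>, so that equality on \<open>\<Omega>\<close> is equality of functions.
  The inner product \<open>ip\<close> is linear in its first argument; its values outside \<open>H\<close> are irrelevant.
\<close>

definition fun_dist :: "('a \<Rightarrow> complex) set \<Rightarrow> (('a \<Rightarrow> complex) \<Rightarrow> ('a \<Rightarrow> complex) \<Rightarrow> complex)
    \<Rightarrow> ('a \<Rightarrow> complex) \<Rightarrow> ('a \<Rightarrow> complex) \<Rightarrow> real"
  where \<comment> \<open>The norm distance on \<open>H\<close>; the guard is there because \<^locale>\<open>Metric_space\<close>
    requires nonnegativity and symmetry outside the carrier as well.\<close>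
    "fun_dist H ip f g =
      (if f \<in> H \<and> g \<in> H then sqrt (Re (ip (\<lambda>x. f x - g x) (\<lambda>x. f x - g x))) else 0)"

locale function_inner_space =
  fixes \<Omega> :: "'a set"
    and H :: "('a \<Rightarrow> complex) set"
    and ip :: "('a \<Rightarrow> complex) \<Rightarrow> ('a \<Rightarrow> complex) \<Rightarrow> complex"
  assumes supported: "f \<in> H \<Longrightarrow> x \<notin> \<Omega> \<Longrightarrow> f x = 0"
    and zero_mem: "(\<lambda>x. 0) \<in> H"
    and add_mem: "f \<in> H \<Longrightarrow> g \<in> H \<Longrightarrow> (\<lambda>x. f x + g x) \<in> H"
    and scale_mem: "f \<in> H \<Longrightarrow> (\<lambda>x. c * f x) \<in> H"
    and ip_add: "f \<in> H \<Longrightarrow> g \<in> H \<Longrightarrow> h \<in> H \<Longrightarrow> ip (\<lambda>x. f x + g x) h = ip f h + ip g h"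
    and ip_scale: "f \<in> H \<Longrightarrow> h \<in> H \<Longrightarrow> ip (\<lambda>x. c * f x) h = c * ip f h"
    and ip_cnj: "f \<in> H \<Longrightarrow> g \<in> H \<Longrightarrow> ip g f = cnj (ip f g)"
    and ip_nonneg: "f \<in> H \<Longrightarrow> 0 \<le> Re (ip f f)"
    and ip_definite: "f \<in> H \<Longrightarrow> ip f f = 0 \<Longrightarrow> f = (\<lambda>x. 0)"
begin

lemma diff_mem: "f \<in> H \<Longrightarrow> g \<in> H \<Longrightarrow> (\<lambda>x. f x - g x) \<in> H"
  using add_mem[of f "\<lambda>x. -1 * g x"] scale_mem[of g "-1"] by simp

lemma ip_self_eq_0_iff: "f \<in> H \<Longrightarrow> ip f f = 0 \<longleftrightarrow> Re (ip f f) = 0"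
  using ip_cnj[of f f] by (simp add: complex_eq_iff)

lemma ip_add_right:
  assumes "f \<in> H" "g \<in> H" "h \<in> H"
  shows "ip h (\<lambda>x. f x + g x) = ip h f + ip h g"
  using ip_cnj[OF add_mem[OF assms(1,2)] assms(3)] ip_cnj[OF assms(1,3)] ip_cnj[OF assms(2,3)]
    ip_add[OF assms] by simp

lemma ip_scale_right:
  assumes "f \<in> H" "h \<in> H"
  shows "ip h (\<lambda>x. c * f x) = cnj c * ip h f"
  using ip_cnj[OF scale_mem[OF assms(1)] assms(2)] ip_cnj[OF assms] ip_scale[OF assms] by simp

lemma ip_expand:
  assumes "f \<in> H" "g \<in> H"
  shows "Re (ip (\<lambda>x. f x + c * g x) (\<lambda>x. f x + c * g x)) =
    Re (ip f f) + 2 * Re (c * ip g f) + (cmod c)\<^sup>2 * Re (ip g g)"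
proof -
  have cg: "(\<lambda>x. c * g x) \<in> H" and s: "(\<lambda>x. f x + c * g x) \<in> H"
    using assms by (auto intro: scale_mem add_mem)
  have "ip (\<lambda>x. f x + c * g x) (\<lambda>x. f x + c * g x)
      = (ip f f + c * ip g f) + (cnj c * ip f g + c * cnj c * ip g g)"
    using assms cg s by (simp add: ip_add ip_add_right ip_scale ip_scale_right algebra_simps)
  moreover have "cnj c * ip f g = cnj (c * ip g f)"
    using ip_cnj[of g f] assms by simp
  moreover have "c * cnj c = of_real ((cmod c)\<^sup>2)"
    by (rule complex_norm_square [symmetric])
  ultimately show ?thesis by simp
qed

lemma Cauchy_Schwarz:
  assumes "f \<in> H" "g \<in> H"
  shows "cmod (ip g f) \<le> sqrt (Re (ip f f)) * sqrt (Re (ip g g))"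
proof -
  define r where "r = Re (ip g g)"
  have r: "0 \<le> r" using assms ip_nonneg r_def by auto
  have "(cmod (ip g f))\<^sup>2 \<le> Re (ip f f) * r"
  proof (cases "r = 0")
    case True
    then have "g = (\<lambda>x. 0)" using assms ip_definite[of g] ip_self_eq_0_iff[of g] by (simp add: r_def)
    then have "ip g f = 0" using ip_scale[of f f 0] assms by simp
    then show ?thesis using r assms ip_nonneg by simp
  next
    case False
    then have r0: "r > 0" using r by simp
    define c where "c = - cnj (ip g f) / of_real r"
    have "0 \<le> Re (ip (\<lambda>x. f x + c * g x) (\<lambda>x. f x + c * g x))"
      using assms by (intro ip_nonneg add_mem scale_mem)
    also have "\<dots> = Re (ip f f) + 2 * Re (c * ip g f) + (cmod c)\<^sup>2 * r"
      using assms by (simp add: ip_expand r_def)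
    also have "c * ip g f = - of_real ((cmod (ip g f))\<^sup>2 / r)"
      using complex_norm_square[of "ip g f"] by (simp add: c_def mult.commute)
    also have "(cmod c)\<^sup>2 * r = (cmod (ip g f))\<^sup>2 / r"
      using r0 by (simp add: c_def norm_divide power_divide power2_eq_square)
    finally have "(cmod (ip g f))\<^sup>2 / r \<le> Re (ip f f)" by simp
    then show ?thesis using r0 by (simp add: field_simps)
  qed
  then show ?thesis
    by (metis r_def real_le_rsqrt real_sqrt_mult)
qed

sublocale Metric_space H "fun_dist H ip"
proof
  fix f g h
  show "0 \<le> fun_dist H ip f g"
    by (auto simp: fun_dist_def ip_nonneg diff_mem)
  have "ip (\<lambda>x. g x - f x) (\<lambda>x. g x - f x) = ip (\<lambda>x. f x - g x) (\<lambda>x. f x - g x)"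
    if fg: "f \<in> H" "g \<in> H"
  proof -
    have d: "(\<lambda>x. f x - g x) \<in> H" using fg diff_mem by auto
    have "(\<lambda>x. g x - f x) = (\<lambda>x. -1 * (f x - g x))" by auto
    then show ?thesis
      using ip_scale[OF d scale_mem[OF d], of "-1" "-1"] ip_scale_right[OF d d, of "-1"] by simp
  qed
  then show "fun_dist H ip f g = fun_dist H ip g f"
    by (simp add: fun_dist_def)
  {
    assume fg: "f \<in> H" "g \<in> H"
    have z: "ip (\<lambda>x. 0) (\<lambda>x. 0) = 0"
      using ip_scale[OF zero_mem zero_mem, of 0] by simp
    have "ip (\<lambda>x. f x - g x) (\<lambda>x. f x - g x) = 0 \<longleftrightarrow> f = g"
    proof
      assume "ip (\<lambda>x. f x - g x) (\<lambda>x. f x - g x) = 0"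
      then have "(\<lambda>x. f x - g x) = (\<lambda>x. 0)" by (rule ip_definite[OF diff_mem[OF fg]])
      then show "f = g" by (metis eq_iff_diff_eq_0 ext)
    next
      assume "f = g"
      then show "ip (\<lambda>x. f x - g x) (\<lambda>x. f x - g x) = 0" using z by simp
    qed
    then show "fun_dist H ip f g = 0 \<longleftrightarrow> f = g"
      using fg ip_self_eq_0_iff[OF diff_mem[OF fg]] by (simp add: fun_dist_def)
  }
  {
    assume fgh: "f \<in> H" "g \<in> H" "h \<in> H"
    let ?u = "\<lambda>x. f x - g x" and ?v = "\<lambda>x. g x - h x"
    have uv: "?u \<in> H" "?v \<in> H" using fgh diff_mem by auto
    define p q where "p = Re (ip ?u ?u)" and "q = Re (ip ?v ?v)"
    have pq: "0 \<le> p" "0 \<le> q" using uv ip_nonneg p_def q_def by auto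
    have "Re (ip (\<lambda>x. f x - h x) (\<lambda>x. f x - h x)) = p + 2 * Re (ip ?v ?u) + q"
      using ip_expand[OF uv, of 1] by (simp add: p_def q_def)
    also have "\<dots> \<le> p + 2 * (sqrt p * sqrt q) + q"
      using Cauchy_Schwarz[OF uv] complex_Re_le_cmod[of "ip ?v ?u"] by (simp add: p_def q_def)
    also have "\<dots> = (sqrt p + sqrt q)\<^sup>2"
      using pq by (simp add: power2_sum)
    finally have "sqrt (Re (ip (\<lambda>x. f x - h x) (\<lambda>x. f x - h x))) \<le> sqrt p + sqrt q"
      using pq by (simp add: real_le_lsqrt)
    then show "fun_dist H ip f h \<le> fun_dist H ip f g + fun_dist H ip g h"
      using fgh by (simp add: fun_dist_def p_def q_def)
  }
qed

end

text \<open>\<open>H\<close> with inner product \<open>ip\<close> is the Hilbert space of functions on \<open>\<Omega>\<close> with reproducing kernel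
  \<open>K\<close>, where \<open>K w\<close> is the kernel function at the point \<open>w\<close>. It is unique when it exists.\<close>

locale reproducing_kernel_Hilbert_space = function_inner_space \<Omega> H ip
  for \<Omega> :: "'a set"
    and K :: "'a \<Rightarrow> 'a \<Rightarrow> complex"
    and H :: "('a \<Rightarrow> complex) set"
    and ip :: "('a \<Rightarrow> complex) \<Rightarrow> ('a \<Rightarrow> complex) \<Rightarrow> complex" +
  assumes complete: "mcomplete"
    and kernel_mem: "w \<in> \<Omega> \<Longrightarrow> (\<lambda>z. if z \<in> \<Omega> then K w z else 0) \<in> H"
    and reproducing: "w \<in> \<Omega> \<Longrightarrow> f \<in> H \<Longrightarrow> ip f (\<lambda>z. if z \<in> \<Omega> then K w z else 0) = f w"

abbreviation unit_disc :: "complex set" where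
  "unit_disc \<equiv> ball 0 1"

definition Hinf :: "(complex \<Rightarrow> complex) set" where
  "Hinf = {f. f holomorphic_on unit_disc \<and> bounded (f ` unit_disc)}"

definition Hinf_norm :: "(complex \<Rightarrow> complex) \<Rightarrow> real" where
  "Hinf_norm f = (SUP z\<in>unit_disc. cmod (f z))"

definition Hinf_closed_ball :: "(complex \<Rightarrow> complex) set" where
  "Hinf_closed_ball = {f \<in> Hinf. Hinf_norm f \<le> 1}"

text \<open>The type of functions is not an instance of \<^class>\<open>real_vector\<close>, so \<^const>\<open>extreme_point_of\<close>
  does not apply. Elements of \<open>H\<^sup>\<infinity>\<close> are compared on the disc only.\<close>

definition extreme_in_Hinf_ball :: "(complex \<Rightarrow> complex) \<Rightarrow> bool" where
  "extreme_in_Hinf_ball b \<longleftrightarrow> b \<in> Hinf_closed_ball \<and>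
    (\<forall>f\<in>Hinf_closed_ball. \<forall>g\<in>Hinf_closed_ball. \<forall>t::real. 0 < t \<and> t < 1 \<and>
      (\<forall>z\<in>unit_disc. b z = of_real (1 - t) * f z + of_real t * g z) \<longrightarrow>
      (\<forall>z\<in>unit_disc. f z = g z))"

definition dBR_kernel :: "(complex \<Rightarrow> complex) \<Rightarrow> complex \<Rightarrow> complex \<Rightarrow> complex" where
  "dBR_kernel b w z = (1 - cnj (b w) * b z) / (1 - cnj w * z)"

locale de_Branges_Rovnyak_space =
  reproducing_kernel_Hilbert_space unit_disc "dBR_kernel b" H ip
  for b :: "complex \<Rightarrow> complex"
    and H :: "(complex \<Rightarrow> complex) set"
    and ip :: "(complex \<Rightarrow> complex) \<Rightarrow> (complex \<Rightarrow> complex) \<Rightarrow> complex" +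
  assumes analytic: "f \<in> H \<Longrightarrow> f holomorphic_on unit_disc"

text \<open>The quotient \<open>(f z - f 0) / z\<close> has a removable singularity at \<open>0\<close>, with value \<open>f' 0\<close>.\<close>

definition backward_shift :: "(complex \<Rightarrow> complex) \<Rightarrow> complex \<Rightarrow> complex" where
  "backward_shift f z =
    (if z \<in> unit_disc then if z = 0 then deriv f 0 else (f z - f 0) / z else 0)"

definition (in Metric_space) hypercyclic :: "('a \<Rightarrow> 'a) \<Rightarrow> bool" where
  "hypercyclic T \<longleftrightarrow> (\<exists>x\<in>M. mtopology closure_of (range (\<lambda>n. (T ^^ n) x)) = M)"

end

theory Submission
  imports Defs
begin

text \<open>
  Write \<open>X\<close> for the backward shift on \<open>\<H>(b)\<close>. The argument rests on two facts about its adjoint.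

  The map \<open>(f, c) \<mapsto> (X f + c X b, f(0) + c b(0))\<close> is a contraction on \<open>\<H>(b) \<oplus> \<complex>\<close>: it is the
  adjoint of an isometry that the kernel identity provides on kernel functions. Hence \<open>X\<close> is
  a contraction, \<open>X b \<in> \<H>(b)\<close>, and evaluation on kernel functions gives \<open>X\<^sup>* g = z g - \<kappa> b\<close> for some
  scalar \<open>\<kappa>\<close> depending on \<open>g\<close> (\<open>X_adjoint\<close>).

  If \<open>b\<close> is extreme, then \<open>b \<notin> \<H>(b)\<close>. Otherwise the contraction annihilates \<open>(- b, 1)\<close>, so that a
  further coordinate can be added to it without losing contractivity. Its transfer function is
  holomorphic, nonzero at \<open>0\<close>, and satisfies \<open>\<bar>a\<bar>\<^sup>2 + \<bar>b\<bar>\<^sup>2 \<le> 1\<close> (\<open>pythagorean_mate_if_symbol_mem\<close>);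
  then \<open>b\<close> is the midpoint of \<open>b \<plusminus> a\<^sup>2 / 2\<close>, both in the unit ball. That \<open>b \<notin> \<H>(b)\<close> makes the
  adjoint computable: whenever \<open>z g = q + d b\<close> with \<open>g\<close> and \<open>q\<close> in \<open>\<H>(b)\<close>, necessarily \<open>X\<^sup>* g = q\<close>
  (\<open>X_adjoint_eqI\<close>).

  If \<open>b(w) = 0\<close> for some \<open>w\<close> in the disc, then \<open>g = b / (z - w)\<close> lies in \<open>\<H>(b)\<close> and \<open>X\<^sup>* g = w g\<close>; an
  operator whose adjoint has an eigenvector is not hypercyclic. If \<open>b\<close> has no zero, then \<open>X\<^sup>*\<close> is
  invertible, and \<open>(X\<^sup>*)\<^sup>-\<^sup>n f\<close> is \<open>(f - b p\<^sub>n) / z\<^sup>n\<close> with the Taylor polynomial \<open>p\<^sub>n\<close> of \<open>f / b\<close> of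
  degree less than \<open>n\<close>. The Taylor coefficients of \<open>f / b\<close> are bounded by a multiple of \<open>r\<^sup>n\<close> for
  every \<open>r > 1\<close>, and hence so are the norms of these functions. For \<open>\<bar>c\<bar> > 1\<close> the identity
  \<open>\<langle>(c X)\<^sup>n f, (X\<^sup>*)\<^sup>-\<^sup>n f\<rangle> = c\<^sup>n \<parallel>f\<parallel>\<^sup>2\<close> then keeps the orbit of \<open>f\<close> away from \<open>0\<close>; for \<open>\<bar>c\<bar> \<le> 1\<close> orbits are
  bounded.
\<close>

section \<open>Representing functionals in a complete function space\<close>

text \<open>The first-order condition at an approximate minimum: a quadratic that drops by at most \<open>e\<close> below
  its value at \<open>0\<close> has a small linear part.\<close>

lemma cmod_square_le_if_quadratic_nonneg:
  fixes z :: complex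
  assumes quad: "\<And>t. 0 \<le> e + 2 * Re (t * z) + (cmod t)\<^sup>2 * s"
    and s: "0 \<le> s"
  shows "(cmod z)\<^sup>2 \<le> e * s"
proof -
  have along: "0 \<le> e - 2 * \<tau> * (cmod z)\<^sup>2 + \<tau>\<^sup>2 * (cmod z)\<^sup>2 * s" for \<tau> :: real
  proof -
    have "(- of_real \<tau> * cnj z) * z = of_real (- \<tau> * (cmod z)\<^sup>2)"
      using complex_norm_square[of z] by (simp add: mult.commute)
    then have "Re ((- of_real \<tau> * cnj z) * z) = - \<tau> * (cmod z)\<^sup>2"
      by (metis Re_complex_of_real)
    then show ?thesis
      using quad[of "- of_real \<tau> * cnj z"] by (simp add: norm_mult power_mult_distrib)
  qed
  show ?thesis
  proof (cases "s = 0")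
    case True
    have "z = 0"
    proof (rule ccontr)
      assume "z \<noteq> 0"
      then have "2 * ((e + 1) / (2 * (cmod z)\<^sup>2)) * (cmod z)\<^sup>2 = e + 1"
        by (simp add: field_simps)
      then show False
        using along[of "(e + 1) / (2 * (cmod z)\<^sup>2)"] True by simp
    qed
    then show ?thesis using True by simp
  next
    case False
    then have eq: "e - 2 * (1 / s) * (cmod z)\<^sup>2 + (1 / s)\<^sup>2 * (cmod z)\<^sup>2 * s = e - (cmod z)\<^sup>2 / s"
      by (simp add: power2_eq_square field_simps)
    have "0 \<le> e - (cmod z)\<^sup>2 / s"
      using along[of "1 / s"] unfolding eq .
    then show ?thesis
      using False s by (simp add: field_simps)
  qed
qed

context function_inner_space
begin

definition nrm :: "('a \<Rightarrow> complex) \<Rightarrow> real" where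
  "nrm f = sqrt (Re (ip f f))"

lemma nrm_nonneg: "f \<in> H \<Longrightarrow> 0 \<le> nrm f"
  by (simp add: nrm_def ip_nonneg)

lemma nrm_square: "f \<in> H \<Longrightarrow> (nrm f)\<^sup>2 = Re (ip f f)"
  by (simp add: nrm_def ip_nonneg)

lemma ip_self: "f \<in> H \<Longrightarrow> ip f f = of_real ((nrm f)\<^sup>2)"
  using ip_cnj[of f f] by (simp add: nrm_square complex_eq_iff)

lemma cmod_ip_le: "f \<in> H \<Longrightarrow> g \<in> H \<Longrightarrow> cmod (ip f g) \<le> nrm f * nrm g"
  using Cauchy_Schwarz[of g f] by (simp add: nrm_def mult.commute)

lemma fun_dist_eq_nrm: "f \<in> H \<Longrightarrow> g \<in> H \<Longrightarrow> fun_dist H ip f g = nrm (\<lambda>x. f x - g x)"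
  by (simp add: fun_dist_def nrm_def)

lemma nrm_zero_imp: "f \<in> H \<Longrightarrow> nrm f = 0 \<Longrightarrow> f = (\<lambda>x. 0)"
  using ip_definite[of f] ip_self[of f] by simp

lemma ip_zero_left: "g \<in> H \<Longrightarrow> ip (\<lambda>x. 0) g = 0"
  using ip_scale[OF zero_mem, of g 0] by simp

lemma ip_diff: "f \<in> H \<Longrightarrow> g \<in> H \<Longrightarrow> h \<in> H \<Longrightarrow> ip (\<lambda>x. f x - g x) h = ip f h - ip g h"
  using ip_add[of f "\<lambda>x. -1 * g x" h] scale_mem[of g "-1"] ip_scale[of g h "-1"] by simp

lemma ip_diff_right: "f \<in> H \<Longrightarrow> g \<in> H \<Longrightarrow> h \<in> H \<Longrightarrow> ip h (\<lambda>x. f x - g x) = ip h f - ip h g"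
  using ip_diff[of f g h] ip_cnj[of f h] ip_cnj[of g h] ip_cnj[OF diff_mem, of f g h] by simp

lemma nrm_scale: "f \<in> H \<Longrightarrow> nrm (\<lambda>x. c * f x) = cmod c * nrm f"
proof -
  assume f: "f \<in> H"
  have "ip (\<lambda>x. c * f x) (\<lambda>x. c * f x) = of_real ((cmod c)\<^sup>2) * ip f f"
    using f scale_mem[OF f] complex_norm_square[of c] by (simp add: ip_scale ip_scale_right)
  then show ?thesis by (simp add: nrm_def real_sqrt_mult)
qed

lemma nrm_diff_triangle: "f \<in> H \<Longrightarrow> g \<in> H \<Longrightarrow> nrm (\<lambda>x. f x - g x) \<le> nrm f + nrm g"
proof -
  assume f: "f \<in> H" and g: "g \<in> H"
  have "fun_dist H ip f g \<le> fun_dist H ip f (\<lambda>x. 0) + fun_dist H ip (\<lambda>x. 0) g"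
    using f zero_mem g by (rule triangle)
  then show ?thesis
    using f g zero_mem fun_dist_eq_nrm[of g "\<lambda>x. 0"] commute[of "\<lambda>x. 0" g]
    by (simp add: fun_dist_eq_nrm)
qed

lemma nrm_expand:
  assumes "f \<in> H" "g \<in> H"
  shows "(nrm (\<lambda>x. f x + c * g x))\<^sup>2 = (nrm f)\<^sup>2 + 2 * Re (c * ip g f) + (cmod c)\<^sup>2 * (nrm g)\<^sup>2"
  using assms ip_expand[OF assms, of c] by (simp add: nrm_square add_mem scale_mem)

text \<open>The Riesz representation theorem, for a functional given by its graph \<open>R\<close> on a subspace that
  need not be closed; the bound makes the graph single valued. Approximate minimisers of
  \<open>\<parallel>u\<parallel>\<^sup>2 - 2 Re l\<close> over \<open>R\<close> represent the functional up to small errors, which also forces them to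
  be Cauchy, and their limit represents it exactly.\<close>

lemma Riesz_representation_graph:
  assumes complete: "mcomplete"
    and mem: "\<And>u l. R u l \<Longrightarrow> u \<in> H"
    and zero: "R (\<lambda>x. 0) 0"
    and add: "\<And>u l v k. R u l \<Longrightarrow> R v k \<Longrightarrow> R (\<lambda>x. u x + v x) (l + k)"
    and scale: "\<And>u l c. R u l \<Longrightarrow> R (\<lambda>x. c * u x) (c * l)"
    and bound: "\<And>u l. R u l \<Longrightarrow> cmod l \<le> C * nrm u"
    and C: "0 \<le> C"
  shows "\<exists>g\<in>H. nrm g \<le> C \<and> (\<forall>u l. R u l \<longrightarrow> ip u g = l)"
proof -
  define J where "J u l = (nrm u)\<^sup>2 - 2 * Re l" for u l
  define S where "S = {J u l | u l. R u l}"
  define m where "m = Inf S"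
  have lower: "- C\<^sup>2 \<le> J u l" if "R u l" for u l
  proof -
    have "Re l \<le> C * nrm u" using bound[OF that] complex_Re_le_cmod order_trans by blast
    moreover have "0 \<le> (nrm u - C)\<^sup>2" by simp
    ultimately show ?thesis unfolding J_def power2_diff by (simp add: mult.commute)
  qed
  have bdd: "bdd_below S" unfolding S_def using lower by (auto intro!: bdd_belowI[of _ "- C\<^sup>2"])
  have m_le: "m \<le> J u l" if "R u l" for u l
    unfolding m_def by (rule cInf_lower[OF _ bdd]) (use that in \<open>auto simp: S_def\<close>)
  have "S \<noteq> {}" using zero by (auto simp: S_def)
  have "\<exists>u l. R u l \<and> J u l < m + (1 / real (Suc n))\<^sup>2" for n
  proof -
    have "Inf S < m + (1 / real (Suc n))\<^sup>2" by (simp add: m_def)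
    then obtain s where "s \<in> S" "s < m + (1 / real (Suc n))\<^sup>2"
      using cInf_lessD[OF \<open>S \<noteq> {}\<close>] by blast
    then show ?thesis by (auto simp: S_def)
  qed
  then obtain u l where R: "\<And>n. R (u n) (l n)"
    and J: "\<And>n. J (u n) (l n) < m + (1 / real (Suc n))\<^sup>2"
    by metis
  have uH: "u n \<in> H" for n using R mem by blast
  \<comment> \<open>The first variation at an approximate minimiser is small.\<close>
  have approx: "cmod (ip v (u n) - k) \<le> 1 / real (Suc n) * nrm v" if v: "R v k" for v k n
  proof -
    have "(cmod (ip v (u n) - k))\<^sup>2 \<le> (1 / real (Suc n))\<^sup>2 * (nrm v)\<^sup>2"
    proof (rule cmod_square_le_if_quadratic_nonneg)
      fix t
      have "m \<le> J (\<lambda>x. u n x + t * v x) (l n + t * k)"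
        by (rule m_le, rule add[OF R scale[OF v]])
      also have "\<dots> = J (u n) (l n) + 2 * Re (t * (ip v (u n) - k)) + (cmod t)\<^sup>2 * (nrm v)\<^sup>2"
        using mem[OF v] uH by (simp add: J_def nrm_expand algebra_simps)
      finally show "0 \<le> (1 / real (Suc n))\<^sup>2 + 2 * Re (t * (ip v (u n) - k)) + (cmod t)\<^sup>2 * (nrm v)\<^sup>2"
        using J[of n] by linarith
    qed simp
    then have "(cmod (ip v (u n) - k))\<^sup>2 \<le> (1 / real (Suc n) * nrm v)\<^sup>2"
      by (simp only: power_mult_distrib)
    then show ?thesis
      by (rule power2_le_imp_le) (use nrm_nonneg[OF mem[OF v]] in simp)
  qed
  have close: "nrm (\<lambda>x. u n x - u k x) \<le> 1 / real (Suc n) + 1 / real (Suc k)" for n k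
  proof -
    let ?v = "\<lambda>x. u n x - u k x"
    have v: "R ?v (l n - l k)"
      using add[OF R[of n] scale[OF R[of k], of "-1"]] by simp
    have vH: "?v \<in> H" using v mem by blast
    have "(nrm ?v)\<^sup>2 = cmod (ip ?v ?v)" using vH by (simp add: ip_self norm_power)
    also have "ip ?v ?v = (ip ?v (u n) - (l n - l k)) - (ip ?v (u k) - (l n - l k))"
      using vH uH by (simp add: ip_diff_right)
    also have "cmod \<dots> \<le> (1 / real (Suc n) + 1 / real (Suc k)) * nrm ?v"
      using norm_triangle_ineq4 approx[OF v, of n] approx[OF v, of k]
      by (smt (verit) distrib_right)
    finally have "nrm ?v * nrm ?v \<le> (1 / real (Suc n) + 1 / real (Suc k)) * nrm ?v"
      by (simp add: power2_eq_square)
    then show ?thesis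
      using nrm_nonneg[OF vH] by (cases "nrm ?v = 0") auto
  qed
  have "MCauchy u"
    unfolding MCauchy_def
  proof (intro conjI allI impI)
    show "range u \<subseteq> H" using uH by auto
    fix \<epsilon> :: real assume "\<epsilon> > 0"
    then obtain N where N: "1 / real (Suc N) < \<epsilon> / 2"
      using nat_approx_posE[of "\<epsilon> / 2"] by auto
    have "fun_dist H ip (u n) (u k) < \<epsilon>" if "N \<le> n" "N \<le> k" for n k
    proof -
      have "1 / real (Suc n) \<le> 1 / real (Suc N)" "1 / real (Suc k) \<le> 1 / real (Suc N)"
        using that by (auto intro!: divide_left_mono)
      then show ?thesis using close[of n k] N uH by (simp add: fun_dist_eq_nrm)
    qed
    then show "\<exists>N. \<forall>n n'. N \<le> n \<longrightarrow> N \<le> n' \<longrightarrow> fun_dist H ip (u n) (u n') < \<epsilon>" by blast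
  qed
  then obtain g where "limitin mtopology u g sequentially"
    using complete by (auto simp: mcomplete_def)
  then have g: "g \<in> H" and lim0: "(\<lambda>n. fun_dist H ip (u n) g) \<longlonglongrightarrow> 0"
    by (auto simp: limitin_metric_dist_null)
  have lim: "(\<lambda>n. nrm (\<lambda>x. u n x - g x)) \<longlonglongrightarrow> 0"
    using lim0 uH g by (simp add: fun_dist_eq_nrm)
  have rep: "ip v g = k" if v: "R v k" for v k
  proof -
    have vH: "v \<in> H" using v mem by blast
    have "cmod (ip v g - k) \<le> 1 / real (Suc n) * nrm v + nrm v * nrm (\<lambda>x. u n x - g x)" for n
    proof -
      have "ip v g - k = (ip v (u n) - k) - ip v (\<lambda>x. u n x - g x)"
        using vH uH g by (simp add: ip_diff_right)
      then show ?thesis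
        using norm_triangle_ineq4 approx[OF v, of n] cmod_ip_le[OF vH diff_mem[OF uH g], of n]
        by (smt (verit))
    qed
    moreover have "(\<lambda>n. 1 / real (Suc n) * nrm v + nrm v * nrm (\<lambda>x. u n x - g x))
        \<longlonglongrightarrow> 0 * nrm v + nrm v * 0"
      by (intro tendsto_intros lim LIMSEQ_Suc[OF lim_1_over_n])
    ultimately have "cmod (ip v g - k) \<le> 0"
      by (intro LIMSEQ_le_const[where x = 0 and X = "\<lambda>n. 1 / real (Suc n) * nrm v + nrm v * nrm (\<lambda>x. u n x - g x)", simplified])
        auto
    then show ?thesis by simp
  qed
  have "nrm g * nrm g \<le> C * nrm g"
  proof -
    have step: "nrm g * nrm g \<le> C * nrm g + (C + nrm g) * nrm (\<lambda>x. u n x - g x)" for n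
    proof -
      let ?\<delta> = "nrm (\<lambda>x. u n x - g x)"
      have dH: "(\<lambda>x. u n x - g x) \<in> H" using diff_mem[OF uH g] .
      have un: "nrm (u n) \<le> nrm g + ?\<delta>"
        using nrm_expand[OF g dH, of 1] cmod_ip_le[OF dH g] complex_Re_le_cmod[of "ip (\<lambda>x. u n x - g x) g"]
          nrm_nonneg[OF g] nrm_nonneg[OF dH]
        by (intro power2_le_imp_le[of "nrm (u n)"]) (auto simp: power2_sum algebra_simps)
      have "nrm g * nrm g = cmod (ip g g)" using g by (simp add: ip_self norm_power power2_eq_square norm_mult)
      also have "ip g g = ip (u n) g - ip (\<lambda>x. u n x - g x) g"
        using uH g by (simp add: ip_diff)
      also have "cmod \<dots> \<le> cmod (l n) + ?\<delta> * nrm g"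
        using norm_triangle_ineq4[of "ip (u n) g" "ip (\<lambda>x. u n x - g x) g"] rep[OF R, of n]
          cmod_ip_le[OF dH g] by simp
      also have "cmod (l n) \<le> C * nrm (u n)" by (rule bound[OF R])
      also have "\<dots> \<le> C * (nrm g + ?\<delta>)" using un C by (rule mult_left_mono)
      finally show ?thesis by (simp add: algebra_simps)
    qed
    have "(\<lambda>n. C * nrm g + (C + nrm g) * nrm (\<lambda>x. u n x - g x)) \<longlonglongrightarrow> C * nrm g + (C + nrm g) * 0"
      by (intro tendsto_intros lim)
    then show ?thesis
      using step by (intro LIMSEQ_le_const) auto
  qed
  then have "nrm g \<le> C"
    using nrm_nonneg[OF g] C by (cases "nrm g = 0") auto
  with g rep show ?thesis by blast
qed

end

text \<open>The span of the triples \<open>(v i, p i, e i)\<close>, as a relation. A map \<open>v i \<mapsto> (p i, e i)\<close> can be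
  extended linearly through it before it is known that the extension is single valued.\<close>

inductive joint_span ::
  "('i \<Rightarrow> 'a \<Rightarrow> complex) \<Rightarrow> ('i \<Rightarrow> 'a \<Rightarrow> complex) \<Rightarrow> ('i \<Rightarrow> complex) \<Rightarrow> 'i set
    \<Rightarrow> ('a \<Rightarrow> complex) \<Rightarrow> ('a \<Rightarrow> complex) \<Rightarrow> complex \<Rightarrow> bool"
  for v p e I where
  gen: "i \<in> I \<Longrightarrow> joint_span v p e I (v i) (p i) (e i)"
| zero: "joint_span v p e I (\<lambda>x. 0) (\<lambda>x. 0) 0"
| add: "joint_span v p e I u q s \<Longrightarrow> joint_span v p e I u' q' s'
    \<Longrightarrow> joint_span v p e I (\<lambda>x. u x + u' x) (\<lambda>x. q x + q' x) (s + s')"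
| scale: "joint_span v p e I u q s \<Longrightarrow> joint_span v p e I (\<lambda>x. c * u x) (\<lambda>x. c * q x) (c * s)"

context function_inner_space
begin

text \<open>Matching inner products make \<open>v i \<mapsto> (p i, e i)\<close> extend to an isometry of the closed span of
  the \<open>v i\<close> into \<open>H \<oplus> \<complex>\<close>. The function \<open>g\<close> is the image of \<open>(f, c)\<close> under the adjoint of this
  isometry, which is a contraction.\<close>

lemma adjoint_of_isometric_matching:
  assumes complete: "mcomplete"
    and v: "\<And>i. i \<in> I \<Longrightarrow> v i \<in> H"
    and p: "\<And>i. i \<in> I \<Longrightarrow> p i \<in> H"
    and match: "\<And>i j. i \<in> I \<Longrightarrow> j \<in> I \<Longrightarrow> ip (v i) (v j) = ip (p i) (p j) + e i * cnj (e j)"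
    and f: "f \<in> H"
  shows "\<exists>g\<in>H. (nrm g)\<^sup>2 \<le> (nrm f)\<^sup>2 + (cmod c)\<^sup>2
    \<and> (\<forall>i\<in>I. ip g (v i) = ip f (p i) + c * cnj (e i))"
proof -
  let ?T = "joint_span v p e I"
  have mem: "u \<in> H \<and> q \<in> H" if "?T u q s" for u q s
    using that by induction (auto intro: v p zero_mem add_mem scale_mem)
  have matchT: "ip u u' = ip q q' + s * cnj s'"
    if T: "?T u q s" and T': "?T u' q' s'" for u q s u' q' s'
  proof -
    have *: "ip u (v j) = ip q (p j) + s * cnj (e j)" if j: "j \<in> I" for j
      using T
    proof induction
      case (gen i) then show ?case using match j by blast
    next
      case zero then show ?case using v p j by (simp add: ip_zero_left)
    next
      case (add u q s u' q' s')
      then show ?case using mem v p j by (simp add: ip_add algebra_simps)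
    next
      case (scale u q s c)
      then show ?case using mem v p j by (simp add: ip_scale algebra_simps)
    qed
    note uq = mem[OF T]
    show ?thesis
      using T'
    proof induction
      case (gen i) then show ?case using * by blast
    next
      case zero
      then show ?case
        using uq ip_scale_right[OF zero_mem, of u 0] ip_scale_right[OF zero_mem, of q 0] by simp
    next
      case (add u q s u' q' s')
      then show ?case using mem[OF add.hyps(1)] mem[OF add.hyps(2)] uq
        by (simp add: ip_add_right algebra_simps)
    next
      case (scale u q s c)
      then show ?case using mem[OF scale.hyps] uq by (simp add: ip_scale_right algebra_simps)
    qed
  qed
  define C where "C = sqrt ((nrm f)\<^sup>2 + (cmod c)\<^sup>2)"
  define R where "R u l \<longleftrightarrow> (\<exists>q s. ?T u q s \<and> l = ip q f + s * cnj c)" for u l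
  have "\<exists>g\<in>H. nrm g \<le> C \<and> (\<forall>u l. R u l \<longrightarrow> ip u g = l)"
  proof (rule Riesz_representation_graph[OF complete])
    show "u \<in> H" if "R u l" for u l using that mem by (auto simp: R_def)
    show "R (\<lambda>x. 0) 0" unfolding R_def
      by (rule exI[of _ "\<lambda>x. 0"], rule exI[of _ 0]) (simp add: joint_span.zero ip_zero_left f)
    show "R (\<lambda>x. u x + w x) (l + k)" if R: "R u l" "R w k" for u l w k
    proof -
      obtain q s q' s' where T: "?T u q s" "?T w q' s'" and "l = ip q f + s * cnj c" "k = ip q' f + s' * cnj c"
        using R by (auto simp: R_def)
      then have "l + k = ip (\<lambda>x. q x + q' x) f + (s + s') * cnj c"
        using mem f by (simp add: ip_add algebra_simps)
      then show ?thesis unfolding R_def using joint_span.add[OF T] by blast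
    qed
    show "R (\<lambda>x. a * u x) (a * l)" if R: "R u l" for u l a
    proof -
      obtain q s where T: "?T u q s" and "l = ip q f + s * cnj c" using R by (auto simp: R_def)
      then have "a * l = ip (\<lambda>x. a * q x) f + (a * s) * cnj c"
        using mem f by (simp add: ip_scale algebra_simps)
      then show ?thesis unfolding R_def using joint_span.scale[OF T] by blast
    qed
    show "cmod l \<le> C * nrm u" if R: "R u l" for u l
    proof -
      obtain q s where T: "?T u q s" and l: "l = ip q f + s * cnj c" using R by (auto simp: R_def)
      have H: "u \<in> H" "q \<in> H" using mem T by auto
      have "of_real ((nrm u)\<^sup>2) = complex_of_real ((nrm q)\<^sup>2 + (cmod s)\<^sup>2)"
        using matchT[OF T T] H complex_norm_square[of s] by (simp add: ip_self)
      then have u: "nrm u = sqrt ((nrm q)\<^sup>2 + (cmod s)\<^sup>2)"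
        using nrm_nonneg[OF H(1)] by (metis of_real_eq_iff real_sqrt_abs abs_of_nonneg)
      have "cmod l \<le> nrm q * nrm f + cmod s * cmod c"
        unfolding l using norm_triangle_ineq[of "ip q f" "s * cnj c"] cmod_ip_le[OF H(2) f]
        by (simp add: norm_mult)
      also have "\<dots> \<le> C * nrm u"
      proof (rule power2_le_imp_le)
        have "(C * nrm u)\<^sup>2 - (nrm q * nrm f + cmod s * cmod c)\<^sup>2 = (nrm f * cmod s - nrm q * cmod c)\<^sup>2"
          by (simp add: C_def u power_mult_distrib) (simp add: power2_eq_square algebra_simps)
        then show "(nrm q * nrm f + cmod s * cmod c)\<^sup>2 \<le> (C * nrm u)\<^sup>2"
          by (smt (verit) zero_le_power2)
        show "0 \<le> C * nrm u" using nrm_nonneg[OF H(1)] by (simp add: C_def)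
      qed
      finally show ?thesis .
    qed
    show "0 \<le> C" by (simp add: C_def)
  qed
  then obtain g where g: "g \<in> H" "nrm g \<le> C" and rep: "\<And>u l. R u l \<Longrightarrow> ip u g = l" by blast
  have "ip g (v i) = ip f (p i) + c * cnj (e i)" if i: "i \<in> I" for i
  proof -
    have "ip (v i) g = ip (p i) f + e i * cnj c"
      by (rule rep) (use joint_span.gen[OF i, of v p e] in \<open>unfold R_def, blast\<close>)
    then have "cnj (ip (v i) g) = cnj (ip (p i) f) + cnj (e i) * c" by simp
    then show ?thesis
      using ip_cnj[OF v[OF i] g(1)] ip_cnj[OF p[OF i] f] by simp
  qed
  moreover have "(nrm g)\<^sup>2 \<le> (nrm f)\<^sup>2 + (cmod c)\<^sup>2"
    using power_mono[OF g(2) nrm_nonneg[OF g(1)], of 2] by (simp add: C_def)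
  ultimately show ?thesis using g(1) by blast
qed

end

section \<open>The backward shift on a de Branges-Rovnyak space\<close>

text \<open>At \<open>0\<close> the equation carries no information, but continuity of \<open>g\<close> there forces
  \<open>g 0 = deriv f 0\<close>.\<close>

lemma backward_shift_eqI:
  assumes hol: "g holomorphic_on unit_disc"
    and supp: "\<And>z. z \<notin> unit_disc \<Longrightarrow> g z = 0"
    and eq: "\<And>z. z \<in> unit_disc \<Longrightarrow> z * g z = f z - f 0"
  shows "backward_shift f = g"
proof
  have "continuous_on unit_disc g" using hol by (rule holomorphic_on_imp_continuous_on)
  then have "g \<midarrow>0\<rightarrow> g 0"
    by (simp add: continuous_on_eq_continuous_at isCont_def)
  moreover have "\<forall>\<^sub>F z in at 0. g z = (f (0 + z) - f 0) / z"
  proof -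
    have "\<forall>\<^sub>F z in at (0::complex). z \<in> unit_disc"
      by (rule eventually_at_in_open') auto
    moreover have "\<forall>\<^sub>F z in at (0::complex). z \<noteq> 0" by (simp add: eventually_at_filter)
    ultimately show ?thesis
    proof eventually_elim
      case (elim z)
      then show ?case using eq[OF elim(1)] by (simp add: nonzero_eq_divide_eq mult.commute)
    qed
  qed
  ultimately have "(\<lambda>z. (f (0 + z) - f 0) / z) \<midarrow>0\<rightarrow> g 0"
    by (rule Lim_transform_eventually)
  then have "DERIV f 0 :> g 0" by (simp add: DERIV_def)
  then have d: "deriv f 0 = g 0" by (rule DERIV_imp_deriv)
  fix z
  show "backward_shift f z = g z"
    using d supp[of z] eq[of z]
    by (auto simp del: mem_ball simp: backward_shift_def nonzero_divide_eq_eq mult.commute)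
qed

lemma mult_backward_shift: "z \<in> unit_disc \<Longrightarrow> z * backward_shift f z = f z - f 0"
  by (simp add: backward_shift_def)

lemma mult_backward_shift_combination:
  assumes "z \<in> unit_disc"
  shows "z * (a * backward_shift f z + c * backward_shift g z) = a * (f z - f 0) + c * (g z - g 0)"
  unfolding mult_backward_shift[OF assms, symmetric] by (simp add: algebra_simps)

lemma one_minus_cnj_mult_nonzero:
  assumes "w \<in> unit_disc" "z \<in> unit_disc"
  shows "1 - cnj w * z \<noteq> 0"
proof
  assume "1 - cnj w * z = 0"
  then have "cmod (cnj w * z) = 1" by simp
  moreover have "cmod w * cmod z < 1 * 1"
    using assms by (intro mult_strict_mono) auto
  ultimately show False by (simp add: norm_mult)
qed

context de_Branges_Rovnyak_space
begin

abbreviation X :: "(complex \<Rightarrow> complex) \<Rightarrow> complex \<Rightarrow> complex" where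
  "X \<equiv> backward_shift"

definition ker_fun :: "complex \<Rightarrow> complex \<Rightarrow> complex" where
  "ker_fun w = (\<lambda>z. if z \<in> unit_disc then dBR_kernel b w z else 0)"

lemma ker_fun_mem: "w \<in> unit_disc \<Longrightarrow> ker_fun w \<in> H"
  unfolding ker_fun_def by (rule kernel_mem)

lemma ip_ker_fun: "w \<in> unit_disc \<Longrightarrow> f \<in> H \<Longrightarrow> ip f (ker_fun w) = f w"
  unfolding ker_fun_def by (rule reproducing)

lemma ker_fun_eq: "z \<in> unit_disc \<Longrightarrow> ker_fun w z = (1 - cnj (b w) * b z) / (1 - cnj w * z)"
  by (simp add: ker_fun_def dBR_kernel_def)

lemma ker_fun_0: "z \<in> unit_disc \<Longrightarrow> ker_fun 0 z = 1 - cnj (b 0) * b z"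
  by (simp add: ker_fun_eq)

text \<open>The kernel identity \<open>(1 - \<lambda>\<^sup>* z) k\<^sub>\<lambda> z = 1 - b(\<lambda>)\<^sup>* b z\<close> says that the vectors
  \<open>(k\<^sub>w - k\<^sub>0, b(w)\<^sup>* - b(0)\<^sup>*) / w\<^sup>*\<close> in \<open>H \<oplus> \<complex>\<close> have the same Gram matrix as the
  \<open>k\<^sub>w\<close>, for \<open>w \<noteq> 0\<close>. The adjoint of the resulting isometry takes \<open>(f, c)\<close> to the function whose value
  at \<open>w\<close> is the pairing of \<open>(f, c)\<close> with such a vector, that is, to the difference quotient of
  \<open>f + c b\<close>.\<close>

lemma difference_quotient_mem:
  assumes f: "f \<in> H"
  shows "\<exists>g\<in>H. (nrm g)\<^sup>2 \<le> (nrm f)\<^sup>2 + (cmod c)\<^sup>2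
    \<and> (\<forall>z\<in>unit_disc. z * g z = (f z + c * b z) - (f 0 + c * b 0))"
proof -
  define I where "I = unit_disc - {0}"
  define p where "p w = (\<lambda>z. (1 / cnj w) * (ker_fun w z - ker_fun 0 z))" for w
  define e where "e w = cnj (b w - b 0) / cnj w" for w
  have dH: "(\<lambda>z. ker_fun w z - ker_fun 0 z) \<in> H" if "w \<in> unit_disc" for w
    using that by (intro diff_mem ker_fun_mem) auto
  have pH: "p w \<in> H" if "w \<in> I" for w
    unfolding p_def using that dH by (intro scale_mem) (auto simp: I_def)
  have "\<exists>g\<in>H. (nrm g)\<^sup>2 \<le> (nrm f)\<^sup>2 + (cmod c)\<^sup>2
    \<and> (\<forall>w\<in>I. ip g (ker_fun w) = ip f (p w) + c * cnj (e w))"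
  proof (rule adjoint_of_isometric_matching[OF complete])
    fix i j assume ij: "i \<in> I" "j \<in> I"
    then have D: "i \<in> unit_disc" "j \<in> unit_disc" "(0::complex) \<in> unit_disc" "i \<noteq> 0" "j \<noteq> 0"
      by (auto simp: I_def)
    have nz: "1 - cnj i * j \<noteq> 0" using D one_minus_cnj_mult_nonzero by blast
    have "ip (p i) (p j) = (1 / cnj i) * (1 / j) *
        ((ker_fun i j - ker_fun 0 j) - (ker_fun i 0 - ker_fun 0 0))"
      using D dH ker_fun_mem scale_mem[OF dH[OF D(2)]]
      by (simp add: p_def ip_scale ip_scale_right ip_diff_right ip_ker_fun del: mem_ball times_divide_eq_left divide_divide_eq_left)
    also have "ker_fun i j - ker_fun 0 j - (ker_fun i 0 - ker_fun 0 0)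
        = ker_fun i j - 1 + cnj (b i) * b j - cnj (b i - b 0) * (b j - b 0)"
      using D by (simp add: ker_fun_0 ker_fun_eq[of 0 i] algebra_simps del: mem_ball)
    also have "\<dots> = cnj i * j * ker_fun i j - cnj (b i - b 0) * (b j - b 0)"
    proof -
      have "ker_fun i j * (1 - cnj i * j) = 1 - cnj (b i) * b j"
        using D(2) nz by (simp add: ker_fun_eq)
      then show ?thesis by (simp add: algebra_simps)
    qed
    finally have "ip (p i) (p j) = ker_fun i j - e i * cnj (e j)"
      using D by (simp add: e_def field_simps)
    then show "ip (ker_fun i) (ker_fun j) = ip (p i) (p j) + e i * cnj (e j)"
      using D by (simp add: ip_ker_fun ker_fun_mem)
  qed (use f pH in \<open>auto simp: I_def intro: ker_fun_mem\<close>)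
  then obtain g where g: "g \<in> H" "(nrm g)\<^sup>2 \<le> (nrm f)\<^sup>2 + (cmod c)\<^sup>2"
    and rep: "\<And>w. w \<in> I \<Longrightarrow> ip g (ker_fun w) = ip f (p w) + c * cnj (e w)" by blast
  have "z * g z = (f z + c * b z) - (f 0 + c * b 0)" if z: "z \<in> unit_disc" for z
  proof (cases "z = 0")
    case False
    then have zI: "z \<in> I" using z by (simp add: I_def)
    have "ip f (p z) = (1 / z) * (f z - f 0)"
      using z f dH[OF z] ker_fun_mem[OF z] ker_fun_mem[of 0] ip_scale_right[OF dH[OF z] f, of "1 / cnj z"]
      by (simp add: p_def ip_diff_right ip_ker_fun del: mult_cancel_left1 times_divide_eq_left)
    then have "g z = (1 / z) * (f z - f 0) + c * ((b z - b 0) / z)"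
      using rep[OF zI] ip_ker_fun[OF z g(1)] by (simp add: e_def)
    then have "z * g z = (f z - f 0) + c * (b z - b 0)"
      using False by (simp add: distrib_left)
    then show ?thesis by (simp add: algebra_simps)
  qed simp
  with g show ?thesis by blast
qed

text \<open>Subtracting the multiple of \<open>(k\<^sub>0, b(0)\<^sup>*)\<close> that makes \<open>f + c b\<close> vanish at \<open>0\<close> does not change the
  difference quotient, and lowers the norm by exactly the missing term.\<close>

lemma difference_quotient_contraction:
  assumes f: "f \<in> H"
  shows "\<exists>g\<in>H. (nrm g)\<^sup>2 + (cmod (f 0 + c * b 0))\<^sup>2 \<le> (nrm f)\<^sup>2 + (cmod c)\<^sup>2
    \<and> (\<forall>z\<in>unit_disc. z * g z = (f z + c * b z) - (f 0 + c * b 0))"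
proof -
  define a where "a = f 0 + c * b 0"
  define f' where "f' = (\<lambda>z. f z + (- a) * ker_fun 0 z)"
  define c' where "c' = c - a * cnj (b 0)"
  have D0: "(0::complex) \<in> unit_disc" by simp
  have f': "f' \<in> H"
    unfolding f'_def using f by (intro add_mem scale_mem ker_fun_mem) auto
  have combo: "f' z + c' * b z = f z + c * b z - a" if "z \<in> unit_disc" for z
    using that by (simp add: f'_def c'_def ker_fun_0 algebra_simps del: mem_ball)
  have k0: "(nrm (ker_fun 0))\<^sup>2 = 1 - (cmod (b 0))\<^sup>2"
  proof -
    have "of_real ((nrm (ker_fun 0))\<^sup>2) = ker_fun 0 0"
      using ip_self[OF ker_fun_mem[OF D0]] ip_ker_fun[OF D0 ker_fun_mem[OF D0]] by simp
    also have "\<dots> = of_real (1 - (cmod (b 0))\<^sup>2)"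
      using complex_norm_square[of "b 0"] ker_fun_0[OF D0] by (simp add: mult.commute)
    finally show ?thesis by (simp only: of_real_eq_iff)
  qed
  have kf: "ip (ker_fun 0) f = cnj (f 0)"
    using ip_cnj[OF f ker_fun_mem[OF D0]] ip_ker_fun[OF D0 f] by simp
  have "(nrm f')\<^sup>2 + (cmod c')\<^sup>2
      = (nrm f)\<^sup>2 + (cmod c)\<^sup>2 - 2 * Re (a * cnj (f 0 + c * b 0)) + (cmod a)\<^sup>2"
  proof -
    have "(nrm f')\<^sup>2 = (nrm f)\<^sup>2 - 2 * Re (a * cnj (f 0)) + (cmod a)\<^sup>2 * (1 - (cmod (b 0))\<^sup>2)"
      unfolding f'_def using f ker_fun_mem[OF D0] by (simp only: nrm_expand k0 kf) simp
    moreover have "(cmod c')\<^sup>2 = (cmod c)\<^sup>2 - 2 * Re (a * cnj (b 0) * cnj c) + (cmod a)\<^sup>2 * (cmod (b 0))\<^sup>2"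
      unfolding c'_def cmod_power2 by (simp add: power2_eq_square algebra_simps)
    ultimately show ?thesis by (simp add: algebra_simps)
  qed
  also have "Re (a * cnj (f 0 + c * b 0)) = (cmod a)\<^sup>2"
    using complex_norm_square[of a] by (metis Re_complex_of_real a_def)
  finally have norms: "(nrm f')\<^sup>2 + (cmod c')\<^sup>2 = (nrm f)\<^sup>2 + (cmod c)\<^sup>2 - (cmod a)\<^sup>2" by simp
  obtain g where g: "g \<in> H" "(nrm g)\<^sup>2 \<le> (nrm f')\<^sup>2 + (cmod c')\<^sup>2"
    and q: "\<forall>z\<in>unit_disc. z * g z = (f' z + c' * b z) - (f' 0 + c' * b 0)"
    using difference_quotient_mem[OF f', of c'] by blast
  have "z * g z = (f z + c * b z) - (f 0 + c * b 0)" if z: "z \<in> unit_disc" for z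
    using q[rule_format, OF z] combo[OF z] combo[OF D0] by (simp add: a_def)
  moreover have "(nrm g)\<^sup>2 + (cmod (f 0 + c * b 0))\<^sup>2 \<le> (nrm f)\<^sup>2 + (cmod c)\<^sup>2"
    using g(2) norms by (simp add: a_def)
  ultimately show ?thesis using g(1) by blast
qed

lemma X_eqI:
  assumes "g \<in> H" "\<And>z. z \<in> unit_disc \<Longrightarrow> z * g z = f z - f 0"
  shows "X f = g"
  using assms by (intro backward_shift_eqI analytic supported)

lemma X_mem: "f \<in> H \<Longrightarrow> X f \<in> H"
proof -
  assume f: "f \<in> H"
  obtain g where "g \<in> H" "\<forall>z\<in>unit_disc. z * g z = (f z + 0 * b z) - (f 0 + 0 * b 0)"
    using difference_quotient_contraction[OF f] by blast
  then show ?thesis using X_eqI[of g f] by simp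
qed

lemma X_symbol_mem: "X b \<in> H"
proof -
  obtain g where "g \<in> H" "\<forall>z\<in>unit_disc. z * g z = (0 + 1 * b z) - (0 + 1 * b 0)"
    using difference_quotient_contraction[OF zero_mem] by blast
  then show ?thesis using X_eqI[of g b] by simp
qed

lemma X_add_scale:
  assumes "f \<in> H" "g \<in> H"
  shows "X (\<lambda>z. f z + c * g z) = (\<lambda>z. X f z + c * X g z)"
proof (rule X_eqI)
  show "(\<lambda>z. X f z + c * X g z) \<in> H" using assms by (intro add_mem scale_mem X_mem)
  show "z * (X f z + c * X g z) = f z + c * g z - (f 0 + c * g 0)" if "z \<in> unit_disc" for z
    using mult_backward_shift_combination[OF that, of 1 f c g] by (simp add: algebra_simps)
qed

lemma X_add_symbol:
  assumes f: "f \<in> H"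
  shows "X (\<lambda>z. f z + c * b z) = (\<lambda>z. X f z + c * X b z)"
proof (rule X_eqI)
  show "(\<lambda>z. X f z + c * X b z) \<in> H" by (rule add_mem[OF X_mem[OF f] scale_mem[OF X_symbol_mem]])
  show "z * (X f z + c * X b z) = f z + c * b z - (f 0 + c * b 0)" if "z \<in> unit_disc" for z
    using mult_backward_shift_combination[OF that, of 1 f c b] by (simp add: algebra_simps)
qed

lemma colligation_contraction:
  assumes f: "f \<in> H"
  shows "(nrm (\<lambda>z. X f z + c * X b z))\<^sup>2 + (cmod (f 0 + c * b 0))\<^sup>2 \<le> (nrm f)\<^sup>2 + (cmod c)\<^sup>2"
proof -
  obtain g where g: "g \<in> H" "(nrm g)\<^sup>2 + (cmod (f 0 + c * b 0))\<^sup>2 \<le> (nrm f)\<^sup>2 + (cmod c)\<^sup>2"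
    and q: "\<forall>z\<in>unit_disc. z * g z = (f z + c * b z) - (f 0 + c * b 0)"
    using difference_quotient_contraction[OF f] by blast
  have "X (\<lambda>z. f z + c * b z) = g" using g q by (intro X_eqI) auto
  moreover have "X (\<lambda>z. f z + c * b z) = (\<lambda>z. X f z + c * X b z)"
    using f by (rule X_add_symbol)
  ultimately show ?thesis using g(2) by simp
qed

lemma nrm_X_le: "f \<in> H \<Longrightarrow> nrm (X f) \<le> nrm f"
proof (rule power2_le_imp_le)
  assume f: "f \<in> H"
  show "(nrm (X f))\<^sup>2 \<le> (nrm f)\<^sup>2"
  proof -
    have "(nrm (X f))\<^sup>2 + (cmod (f 0))\<^sup>2 \<le> (nrm f)\<^sup>2"
      using colligation_contraction[OF f, of 0] by simp
    then show ?thesis using zero_le_power2[of "cmod (f 0)"] by linarith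
  qed
qed (rule nrm_nonneg)

lemma funpow_X_mem: "f \<in> H \<Longrightarrow> (X ^^ n) f \<in> H"
  by (induction n) (auto intro: X_mem)

lemma nrm_funpow_X_le: "f \<in> H \<Longrightarrow> nrm ((X ^^ n) f) \<le> nrm f"
proof (induction n)
  case (Suc n)
  then show ?case using order_trans[OF nrm_X_le[OF funpow_X_mem[OF Suc.prems]]] by simp
qed simp

text \<open>The adjoint of \<open>X\<close> exists by the Riesz theorem; testing it on kernel functions, where
  \<open>X k\<^sub>w = w\<^sup>* k\<^sub>w - b(w)\<^sup>* X b\<close>, identifies it as the forward shift corrected by a multiple of \<open>b\<close>.\<close>

lemma X_adjoint:
  assumes g: "g \<in> H"
  shows "\<exists>h\<in>H. (\<forall>f\<in>H. ip (X f) g = ip f h)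
    \<and> (\<exists>\<kappa>. \<forall>z\<in>unit_disc. h z = z * g z - \<kappa> * b z)"
proof -
  define R where "R f l \<longleftrightarrow> f \<in> H \<and> l = ip (X f) g" for f l
  have "\<exists>h\<in>H. nrm h \<le> nrm g \<and> (\<forall>f l. R f l \<longrightarrow> ip f h = l)"
  proof (rule Riesz_representation_graph[OF complete])
    have zero: "X (\<lambda>z. 0) = (\<lambda>z. 0)" by (rule X_eqI) (auto intro: zero_mem)
    then show "R (\<lambda>z. 0) 0" using g by (simp add: R_def zero_mem ip_zero_left)
    show "R (\<lambda>x. u x + v x) (l + k)" if "R u l" "R v k" for u l v k
      using that X_add_scale[of u v 1] g by (auto simp: R_def intro: add_mem ip_add[symmetric] X_mem)
    show "R (\<lambda>x. c * u x) (c * l)" if "R u l" for u l c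
      using that X_add_scale[OF zero_mem, of u c] zero g
      by (auto simp: R_def intro: scale_mem ip_scale[symmetric] X_mem)
    show "cmod l \<le> nrm g * nrm u" if "R u l" for u l
    proof -
      have u: "u \<in> H" and l: "l = ip (X u) g" using that by (auto simp: R_def)
      have "cmod l \<le> nrm (X u) * nrm g" unfolding l using u g by (intro cmod_ip_le X_mem)
      also have "\<dots> \<le> nrm u * nrm g" using u g by (intro mult_right_mono nrm_X_le nrm_nonneg)
      finally show ?thesis by (simp add: mult.commute)
    qed
  qed (use g in \<open>auto simp: R_def nrm_nonneg\<close>)
  then obtain h where h: "h \<in> H" and adj: "\<And>f. f \<in> H \<Longrightarrow> ip (X f) g = ip f h"
    by (auto simp: R_def)
  have "h w = w * g w - cnj (ip (X b) g) * b w" if w: "w \<in> unit_disc" for w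
  proof -
    have kw: "ker_fun w \<in> H" using w by (rule ker_fun_mem)
    have "X (ker_fun w) = (\<lambda>z. cnj w * ker_fun w z - cnj (b w) * X b z)"
    proof (rule X_eqI)
      show "(\<lambda>z. cnj w * ker_fun w z - cnj (b w) * X b z) \<in> H"
        using kw X_symbol_mem by (intro diff_mem scale_mem)
      fix z assume z: "z \<in> unit_disc"
      have "1 - cnj w * z \<noteq> 0" using w z by (rule one_minus_cnj_mult_nonzero)
      then have "ker_fun w z * (1 - cnj w * z) = 1 - cnj (b w) * b z"
        using z by (simp add: ker_fun_eq)
      moreover have "ker_fun w 0 = 1 - cnj (b w) * b 0" by (simp add: ker_fun_eq)
      ultimately show "z * (cnj w * ker_fun w z - cnj (b w) * X b z) = ker_fun w z - ker_fun w 0"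
        using mult_backward_shift[OF z, of b] by algebra
    qed
    then have "ip (X (ker_fun w)) g = cnj w * ip (ker_fun w) g - cnj (b w) * ip (X b) g"
      using kw g X_symbol_mem by (simp add: ip_diff ip_scale scale_mem)
    moreover have "ip (ker_fun w) g = cnj (g w)" "ip (ker_fun w) h = cnj (h w)"
      using ip_cnj[OF g kw] ip_cnj[OF h kw] ip_ker_fun[OF w g] ip_ker_fun[OF w h] by auto
    ultimately have "cnj (h w) = cnj w * cnj (g w) - cnj (b w) * ip (X b) g"
      using adj[OF kw] by simp
    then have "h w = cnj (cnj w * cnj (g w) - cnj (b w) * ip (X b) g)" by (metis complex_cnj_cnj)
    then show ?thesis by (simp add: mult.commute)
  qed
  with h adj show ?thesis by blast
qed

text \<open>The difference quotient of \<open>b\<close> at \<open>w\<close> is \<open>(1 - w X)\<^sup>-\<^sup>1 X b\<close>, which exists as a fixed point because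
  \<open>X\<close> is a contraction and \<open>\<bar>w\<bar> < 1\<close>.\<close>

lemma symbol_difference_quotient:
  assumes w: "w \<in> unit_disc"
  obtains g where "g \<in> H" "g = (\<lambda>z. X b z + w * X g z)"
    "\<And>z. z \<in> unit_disc \<Longrightarrow> (z - w) * g z = b z - b w" "b w = b 0 + w * g 0"
proof -
  obtain g where g: "g \<in> H" and fp: "(\<lambda>z. X b z + w * X g z) = g"
  proof (rule Banach_fixedpoint_thm[OF complete, of "\<lambda>h z. X b z + w * X h z" "cmod w"])
    show "H \<noteq> {}" using zero_mem by blast
    show "(\<lambda>h z. X b z + w * X h z) \<in> H \<rightarrow> H"
    proof (rule funcsetI)
      fix h assume "h \<in> H"
      then show "(\<lambda>z. X b z + w * X h z) \<in> H"
        by (intro add_mem scale_mem X_mem X_symbol_mem)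
    qed
    show "cmod w < 1" using w by simp
    fix f h assume f: "f \<in> H" and h: "h \<in> H"
    let ?d = "\<lambda>z. f z - h z"
    have d: "?d \<in> H" using f h by (rule diff_mem)
    have "(\<lambda>z. (X b z + w * X f z) - (X b z + w * X h z)) = (\<lambda>z. w * X ?d z)"
      using X_add_scale[OF f h, of "-1"] by (simp add: algebra_simps)
    then have "fun_dist H ip (\<lambda>z. X b z + w * X f z) (\<lambda>z. X b z + w * X h z) = cmod w * nrm (X ?d)"
      using f h d X_mem[OF d]
      by (simp add: fun_dist_eq_nrm nrm_scale add_mem scale_mem X_mem X_symbol_mem)
    also have "\<dots> \<le> cmod w * fun_dist H ip f h"
      using nrm_X_le[OF d] f h by (simp add: fun_dist_eq_nrm mult_left_mono)
    finally show "fun_dist H ip (\<lambda>z. X b z + w * X f z) (\<lambda>z. X b z + w * X h z)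
      \<le> cmod w * fun_dist H ip f h" .
  qed blast
  have eq: "z * g z = b z - b 0 + w * (g z - g 0)" if z: "z \<in> unit_disc" for z
  proof -
    have "z * g z = z * X b z + w * (z * X g z)"
      by (subst fp[symmetric]) (simp add: algebra_simps)
    then show ?thesis by (simp only: mult_backward_shift[OF z])
  qed
  have bw: "b w = b 0 + w * g 0" using eq[OF w] by (simp add: algebra_simps)
  have "(z - w) * g z = b z - b w" if "z \<in> unit_disc" for z
    using eq[OF that] bw by (simp add: algebra_simps)
  then show ?thesis by (rule that[OF g fp[symmetric] _ bw])
qed

end

section \<open>Extreme symbols\<close>

context de_Branges_Rovnyak_space
begin

text \<open>The restriction of \<open>b\<close> that can be compared with elements of \<open>H\<close>, which vanish outside the disc.\<close>

definition symbol :: "complex \<Rightarrow> complex" where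
  "symbol = (\<lambda>z. if z \<in> unit_disc then b z else 0)"

text \<open>If \<open>b \<in> H\<close>, the colligation contraction annihilates \<open>(- b, 1)\<close>. Projecting \<open>(f, c)\<close> onto the
  orthogonal complement of that vector leaves room for an additional term.\<close>

lemma colligation_contraction_defect:
  assumes f: "f \<in> H" and B: "symbol \<in> H"
  shows "(nrm (\<lambda>z. X f z + c * X b z))\<^sup>2 + (cmod (f 0 + c * b 0))\<^sup>2
      + (cmod (c - ip f symbol))\<^sup>2 / (1 + (nrm symbol)\<^sup>2)
    \<le> (nrm f)\<^sup>2 + (cmod c)\<^sup>2"
proof -
  define s where "s = 1 + (nrm symbol)\<^sup>2"
  have s: "s > 0" unfolding s_def using zero_le_power2[of "nrm symbol"] by linarith
  define d where "d = c - ip f symbol"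
  \<comment> \<open>The component of \<open>(f, c)\<close> along \<open>(- b, 1)\<close> is \<open>t\<close> times that vector.\<close>
  define t where "t = d / of_real s"
  define f' where "f' = (\<lambda>z. f z + t * symbol z)"
  define c' where "c' = c - t"
  have f': "f' \<in> H" unfolding f'_def using f B by (intro add_mem scale_mem)
  have combo: "f' z + c' * b z = f z + c * b z" if "z \<in> unit_disc" for z
    using that by (simp add: f'_def c'_def symbol_def algebra_simps)
  have "(\<lambda>z. X f' z + c' * X b z) = (\<lambda>z. X f z + c * X b z)"
  proof -
    have "X (\<lambda>z. f z + c * b z) = (\<lambda>z. X f' z + c' * X b z)"
    proof (rule X_eqI)
      show "(\<lambda>z. X f' z + c' * X b z) \<in> H" by (rule add_mem[OF X_mem[OF f'] scale_mem[OF X_symbol_mem]])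
      show "z * (X f' z + c' * X b z) = f z + c * b z - (f 0 + c * b 0)" if "z \<in> unit_disc" for z
        using mult_backward_shift_combination[OF that, of 1 f' c' b] combo[OF that] combo[of 0]
        by (simp add: algebra_simps)
    qed
    moreover have "X (\<lambda>z. f z + c * b z) = (\<lambda>z. X f z + c * X b z)"
      using f by (rule X_add_symbol)
    ultimately show ?thesis by simp
  qed
  moreover have "f' 0 + c' * b 0 = f 0 + c * b 0" by (rule combo) simp
  ultimately have le: "(nrm (\<lambda>z. X f z + c * X b z))\<^sup>2 + (cmod (f 0 + c * b 0))\<^sup>2
      \<le> (nrm f')\<^sup>2 + (cmod c')\<^sup>2"
    using colligation_contraction[OF f', of c'] by simp
  have "(nrm f')\<^sup>2 + (cmod c')\<^sup>2 = (nrm f)\<^sup>2 + (cmod c)\<^sup>2 - 2 * Re (t * cnj d) + (cmod t)\<^sup>2 * s"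
  proof -
    have "ip symbol f = cnj (ip f symbol)" using ip_cnj[OF f B] .
    then have "(nrm f')\<^sup>2 = (nrm f)\<^sup>2 + 2 * Re (t * cnj (ip f symbol)) + (cmod t)\<^sup>2 * (s - 1)"
      unfolding f'_def s_def using nrm_expand[OF f B, of t] by simp
    moreover have "(cmod c')\<^sup>2 = (cmod c)\<^sup>2 - 2 * Re (t * cnj c) + (cmod t)\<^sup>2"
      unfolding c'_def cmod_power2 by (simp add: power2_eq_square algebra_simps)
    ultimately show ?thesis by (simp add: d_def algebra_simps)
  qed
  moreover have "t * cnj d = of_real ((cmod d)\<^sup>2 / s)"
    using complex_norm_square[of d] by (simp add: t_def)
  moreover have "(cmod t)\<^sup>2 * s = (cmod d)\<^sup>2 / s"
    using s by (simp add: t_def norm_divide power_divide power2_eq_square)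
  ultimately have "(nrm f')\<^sup>2 + (cmod c')\<^sup>2 = (nrm f)\<^sup>2 + (cmod c)\<^sup>2 - (cmod d)\<^sup>2 / s" by simp
  with le show ?thesis by (simp add: d_def s_def)
qed

text \<open>The additional term, evaluated along the vectors \<open>(w Q\<^sub>w, 1)\<close> with
  \<open>Q\<^sub>w = (b - b(w)) / (z - w)\<close>, is \<open>\<bar>a(w)\<bar>\<^sup>2\<close> for a holomorphic \<open>a\<close>. The contraction maps such a vector to
  \<open>(Q\<^sub>w, b(w))\<close>, so the inequality reads
  \<open>\<parallel>Q\<^sub>w\<parallel>\<^sup>2 + \<bar>b(w)\<bar>\<^sup>2 + \<bar>a(w)\<bar>\<^sup>2 \<le> \<bar>w\<bar>\<^sup>2 \<parallel>Q\<^sub>w\<parallel>\<^sup>2 + 1\<close>, and \<open>\<bar>w\<bar> < 1\<close>.\<close>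

lemma pythagorean_mate_if_symbol_mem:
  assumes B: "symbol \<in> H"
  shows "\<exists>a. a holomorphic_on unit_disc \<and> a 0 \<noteq> 0 \<and>
    (\<forall>w\<in>unit_disc. (cmod (a w))\<^sup>2 + (cmod (b w))\<^sup>2 \<le> 1)"
proof -
  have "\<forall>w\<in>unit_disc. \<exists>g. g \<in> H \<and> g = (\<lambda>z. X b z + w * X g z) \<and> b w = b 0 + w * g 0"
    using symbol_difference_quotient by metis
  from bchoice[OF this] obtain Q where
    "\<forall>w\<in>unit_disc. Q w \<in> H \<and> Q w = (\<lambda>z. X b z + w * X (Q w) z) \<and> b w = b 0 + w * Q w 0" ..
  note Q_all = this[rule_format]
  have Q: "Q w \<in> H" and Q_eq: "Q w = (\<lambda>z. X b z + w * X (Q w) z)" and bw: "b w = b 0 + w * Q w 0"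
    if "w \<in> unit_disc" for w
    by (rule conjunct1[OF Q_all[OF that]], rule conjunct1[OF conjunct2[OF Q_all[OF that]]],
      rule conjunct2[OF conjunct2[OF Q_all[OF that]]])
  define \<alpha> where "\<alpha> n = ip ((X ^^ n) (X b)) symbol" for n
  have series: "(\<lambda>n. \<alpha> n * w ^ n) sums ip (Q w) symbol" if w: "w \<in> unit_disc" for w
  proof -
    have iter: "(X ^^ n) (Q w) = (\<lambda>z. (X ^^ n) (X b) z + w * (X ^^ Suc n) (Q w) z)" for n
    proof (induction n)
      case 0
      show ?case unfolding funpow.simps comp_apply id_apply by (rule Q_eq[OF w])
    next
      case (Suc n)
      have "X ((X ^^ n) (Q w)) = X (\<lambda>z. (X ^^ n) (X b) z + w * (X ^^ Suc n) (Q w) z)"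
        by (rule arg_cong[OF Suc.IH])
      also have "\<dots> = (\<lambda>z. X ((X ^^ n) (X b)) z + w * X ((X ^^ Suc n) (Q w)) z)"
        by (rule X_add_scale[OF funpow_X_mem[OF X_symbol_mem] funpow_X_mem[OF Q[OF w]]])
      finally show ?case by simp
    qed
    have partial: "ip (Q w) symbol = (\<Sum>k<n. \<alpha> k * w ^ k) + w ^ n * ip ((X ^^ n) (Q w)) symbol" for n
    proof (induction n)
      case (Suc n)
      have "ip ((X ^^ n) (Q w)) symbol = \<alpha> n + w * ip ((X ^^ Suc n) (Q w)) symbol"
        using arg_cong[OF iter[of n], of "\<lambda>h. ip h symbol"]
          ip_add[OF funpow_X_mem[OF X_symbol_mem, of n] scale_mem[OF funpow_X_mem[OF Q[OF w], of "Suc n"], of w] B]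
          ip_scale[OF funpow_X_mem[OF Q[OF w], of "Suc n"] B, of w]
        by (simp only: \<alpha>_def)
      with Suc.IH show ?case by (simp add: algebra_simps)
    qed simp
    have "(\<lambda>n. w ^ n * ip ((X ^^ n) (Q w)) symbol) \<longlonglongrightarrow> 0"
    proof (rule Lim_null_comparison)
      show "\<forall>\<^sub>F n in sequentially. cmod (w ^ n * ip ((X ^^ n) (Q w)) symbol)
          \<le> cmod w ^ n * (nrm (Q w) * nrm symbol)"
      proof (rule always_eventually, rule allI)
        fix n
        have "cmod (ip ((X ^^ n) (Q w)) symbol) \<le> nrm ((X ^^ n) (Q w)) * nrm symbol"
          using Q[OF w] B by (intro cmod_ip_le funpow_X_mem)
        also have "\<dots> \<le> nrm (Q w) * nrm symbol"
          using Q[OF w] B by (intro mult_right_mono nrm_funpow_X_le nrm_nonneg)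
        finally show "cmod (w ^ n * ip ((X ^^ n) (Q w)) symbol) \<le> cmod w ^ n * (nrm (Q w) * nrm symbol)"
          by (simp add: norm_mult norm_power mult_left_mono)
      qed
      show "(\<lambda>n. cmod w ^ n * (nrm (Q w) * nrm symbol)) \<longlonglongrightarrow> 0"
        using w by (intro tendsto_mult_left_zero LIMSEQ_power_zero) simp
    qed
    then have "(\<lambda>n. ip (Q w) symbol - w ^ n * ip ((X ^^ n) (Q w)) symbol) \<longlonglongrightarrow> ip (Q w) symbol - 0"
      by (intro tendsto_diff tendsto_const)
    moreover have "ip (Q w) symbol - w ^ n * ip ((X ^^ n) (Q w)) symbol = (\<Sum>k<n. \<alpha> k * w ^ k)" for n
      using partial[of n] by (simp add: algebra_simps)
    ultimately show ?thesis by (simp add: sums_def)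
  qed
  then have hol: "(\<lambda>w. ip (Q w) symbol) holomorphic_on unit_disc"
    by (intro power_series_holomorphic[where a = \<alpha>]) simp
  define r where "r = sqrt (1 + (nrm symbol)\<^sup>2)"
  have r: "r > 0" unfolding r_def by (simp add: add_pos_nonneg)
  define a where "a w = (1 - w * ip (Q w) symbol) / of_real r" for w
  have "a holomorphic_on unit_disc"
    unfolding a_def using hol r by (intro holomorphic_intros) auto
  moreover have "a 0 \<noteq> 0" using r by (simp add: a_def)
  moreover have "(cmod (a w))\<^sup>2 + (cmod (b w))\<^sup>2 \<le> 1" if w: "w \<in> unit_disc" for w
  proof -
    have wQ: "(\<lambda>z. w * Q w z) \<in> H" using Q[OF w] by (rule scale_mem)
    have XwQ: "X (\<lambda>z. w * Q w z) = (\<lambda>z. w * X (Q w) z)"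
      using X_add_scale[OF zero_mem Q[OF w], of w] X_eqI[OF zero_mem, of "\<lambda>z. 0"] by simp
    have "(nrm (Q w))\<^sup>2 + (cmod (b w))\<^sup>2 + (cmod (1 - w * ip (Q w) symbol))\<^sup>2 / (1 + (nrm symbol)\<^sup>2)
        \<le> (cmod w * nrm (Q w))\<^sup>2 + 1"
    proof -
      have "(\<lambda>z. X (\<lambda>z. w * Q w z) z + 1 * X b z) = (\<lambda>z. X b z + w * X (Q w) z)"
        by (simp add: XwQ add.commute)
      also have "\<dots> = Q w" by (rule Q_eq[OF w, symmetric])
      finally have "(\<lambda>z. X (\<lambda>z. w * Q w z) z + 1 * X b z) = Q w" .
      moreover have "w * Q w 0 + 1 * b 0 = b w" using bw[OF w] by simp
      ultimately show ?thesis
        using colligation_contraction_defect[OF wQ B, of 1] Q[OF w] B by (simp add: ip_scale nrm_scale)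
    qed
    moreover have "(cmod (1 - w * ip (Q w) symbol))\<^sup>2 / (1 + (nrm symbol)\<^sup>2) = (cmod (a w))\<^sup>2"
      by (simp add: a_def r_def norm_divide power_divide)
    moreover have "(cmod w * nrm (Q w))\<^sup>2 \<le> (nrm (Q w))\<^sup>2"
      using w nrm_nonneg[OF Q[OF w]] by (intro power_mono mult_left_le_one_le) auto
    ultimately show ?thesis by linarith
  qed
  ultimately show ?thesis by blast
qed

end

text \<open>Both \<open>b + a\<^sup>2 / 2\<close> and \<open>b - a\<^sup>2 / 2\<close> lie in the unit ball, since
  \<open>\<bar>b\<bar> \<le> (1 + \<bar>b\<bar>\<^sup>2) / 2 \<le> 1 - \<bar>a\<bar>\<^sup>2 / 2\<close>.\<close>

lemma not_extreme_if_pythagorean_mate: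
  assumes ext: "extreme_in_Hinf_ball b"
    and a: "a holomorphic_on unit_disc"
    and mate: "\<And>z. z \<in> unit_disc \<Longrightarrow> (cmod (a z))\<^sup>2 + (cmod (b z))\<^sup>2 \<le> 1"
  shows "a 0 = 0"
proof -
  have b: "b holomorphic_on unit_disc"
    using ext by (simp add: extreme_in_Hinf_ball_def Hinf_closed_ball_def Hinf_def)
  have ball: "(\<lambda>z. b z + \<sigma> * (a z)\<^sup>2 / 2) \<in> Hinf_closed_ball" if \<sigma>: "cmod \<sigma> = 1" for \<sigma>
  proof -
    have le: "cmod (b z + \<sigma> * (a z)\<^sup>2 / 2) \<le> 1" if z: "z \<in> unit_disc" for z
    proof -
      have "cmod (b z + \<sigma> * (a z)\<^sup>2 / 2) \<le> cmod (b z) + (cmod (a z))\<^sup>2 / 2"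
        using norm_triangle_ineq[of "b z" "\<sigma> * (a z)\<^sup>2 / 2"] \<sigma> by (simp add: norm_mult norm_divide norm_power)
      moreover have "0 \<le> (1 - cmod (b z))\<^sup>2" by simp
      ultimately show ?thesis using mate[OF z] unfolding power2_diff by simp
    qed
    have "(\<lambda>z. b z + \<sigma> * (a z)\<^sup>2 / 2) holomorphic_on unit_disc"
      using a b by (intro holomorphic_intros) auto
    moreover have "Hinf_norm (\<lambda>z. b z + \<sigma> * (a z)\<^sup>2 / 2) \<le> 1"
      unfolding Hinf_norm_def by (rule cSUP_least) (use le in auto)
    ultimately show ?thesis
      using le by (auto simp: Hinf_closed_ball_def Hinf_def bounded_iff simp del: mem_ball
        intro!: exI[of _ 1])
  qed
  have P: "(\<lambda>z. b z + (a z)\<^sup>2 / 2) \<in> Hinf_closed_ball" "(\<lambda>z. b z - (a z)\<^sup>2 / 2) \<in> Hinf_closed_ball"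
    using ball[of 1] ball[of "-1"] by simp_all
  have "b z = of_real (1 - 1/2) * (b z + (a z)\<^sup>2 / 2) + of_real (1/2) * (b z - (a z)\<^sup>2 / 2)" for z
    by (simp add: algebra_simps)
  then have "\<forall>z\<in>unit_disc. b z + (a z)\<^sup>2 / 2 = b z - (a z)\<^sup>2 / 2"
    using ext P unfolding extreme_in_Hinf_ball_def
    by (elim conjE ballE allE[where x = "1/2"]) auto
  then have "(a 0)\<^sup>2 = 0" by (simp add: algebra_simps)
  then show ?thesis by simp
qed

section \<open>Obstructions to hypercyclicity\<close>

context function_inner_space
begin

lemma hypercyclic_orbit_functional:
  assumes "hypercyclic T"
  shows "\<exists>f\<in>H. (\<forall>\<epsilon>>0. \<exists>n. nrm ((T ^^ n) f) < \<epsilon>) \<and>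
    (\<forall>g\<in>H. g \<noteq> (\<lambda>x. 0) \<longrightarrow> (\<forall>y. \<exists>n. cmod (y - ip ((T ^^ n) f) g) < 1))"
proof -
  obtain f where f: "f \<in> H" and dense: "mtopology closure_of (range (\<lambda>n. (T ^^ n) f)) = H"
    using assms by (auto simp: hypercyclic_def)
  have near: "\<exists>n. (T ^^ n) f \<in> H \<and> nrm (\<lambda>x. h x - (T ^^ n) f x) < \<epsilon>" if "h \<in> H" "\<epsilon> > 0" for h \<epsilon>
  proof -
    have "h \<in> mtopology closure_of (range (\<lambda>n. (T ^^ n) f))" using that dense by simp
    then obtain n where "(T ^^ n) f \<in> mball h \<epsilon>"
      using \<open>\<epsilon> > 0\<close> by (auto simp: metric_closure_of)
    then show ?thesis using that by (auto simp: fun_dist_eq_nrm)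
  qed
  have "\<exists>n. nrm ((T ^^ n) f) < \<epsilon>" if "\<epsilon> > 0" for \<epsilon>
  proof -
    obtain n where n: "(T ^^ n) f \<in> H" "nrm (\<lambda>x. 0 - (T ^^ n) f x) < \<epsilon>"
      using near[OF zero_mem \<open>\<epsilon> > 0\<close>] by blast
    then show ?thesis using nrm_scale[OF n(1), of "-1"] by auto
  qed
  moreover have "\<exists>n. cmod (y - ip ((T ^^ n) f) g) < 1" if g: "g \<in> H" "g \<noteq> (\<lambda>x. 0)" for g y
  proof -
    have ng: "nrm g > 0" using g nrm_zero_imp nrm_nonneg by (metis less_eq_real_def)
    define h where "h = (\<lambda>x. (y / of_real ((nrm g)\<^sup>2)) * g x)"
    have h: "h \<in> H" unfolding h_def using g by (intro scale_mem)
    have hg: "ip h g = y"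
      unfolding h_def ip_scale[OF g(1) g(1)] ip_self[OF g(1)] using ng by simp
    obtain n where n: "(T ^^ n) f \<in> H" "nrm (\<lambda>x. h x - (T ^^ n) f x) < 1 / nrm g"
      using near[OF h, of "1 / nrm g"] ng by auto
    have "y - ip ((T ^^ n) f) g = ip (\<lambda>x. h x - (T ^^ n) f x) g"
      using h n g hg by (simp add: ip_diff)
    then have "cmod (y - ip ((T ^^ n) f) g) \<le> nrm (\<lambda>x. h x - (T ^^ n) f x) * nrm g"
      using cmod_ip_le[OF diff_mem[OF h n(1)] g(1)] by simp
    also have "\<dots> < 1" using n(2) ng by (simp add: field_simps)
    finally show ?thesis by blast
  qed
  ultimately show ?thesis using f by blast
qed

text \<open>Pairing with \<open>g\<close> turns the orbit of \<open>f\<close> into the numbers \<open>\<mu>\<^sup>n \<langle>f, g\<rangle>\<close>, which are bounded or bounded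
  away from \<open>0\<close>.\<close>

lemma not_hypercyclic_if_adjoint_eigenvector:
  assumes T: "\<And>f. f \<in> H \<Longrightarrow> T f \<in> H"
    and g: "g \<in> H" "g \<noteq> (\<lambda>x. 0)"
    and eigen: "\<And>f. f \<in> H \<Longrightarrow> ip (T f) g = \<mu> * ip f g"
  shows "\<not> hypercyclic T"
proof
  assume "hypercyclic T"
  then obtain f where f: "f \<in> H" and dense: "\<And>y. \<exists>n. cmod (y - ip ((T ^^ n) f) g) < 1"
    and small: "\<And>\<epsilon>. \<epsilon> > 0 \<Longrightarrow> \<exists>n. nrm ((T ^^ n) f) < \<epsilon>"
    using hypercyclic_orbit_functional g by meson
  have TH: "(T ^^ n) f \<in> H" for n by (induction n) (auto intro: f T)
  have orbit: "cmod (ip ((T ^^ n) f) g) = cmod \<mu> ^ n * cmod (ip f g)" for n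
    by (induction n) (simp_all add: eigen[OF TH] norm_mult)
  show False
  proof (cases "cmod \<mu> \<le> 1 \<or> ip f g = 0")
    case True
    obtain n where n: "cmod (of_real (cmod (ip f g) + 1) - ip ((T ^^ n) f) g) < 1"
      using dense by blast
    have "cmod \<mu> ^ n * cmod (ip f g) \<le> cmod (ip f g)"
      using True by (cases "ip f g = 0") (auto intro!: mult_left_le_one_le power_le_one)
    then have "cmod (ip ((T ^^ n) f) g) \<le> cmod (ip f g)" by (simp only: orbit)
    moreover have "cmod (of_real (cmod (ip f g) + 1)) = cmod (ip f g) + 1"
      by (simp only: norm_of_real) simp
    ultimately show False
      using n norm_triangle_ineq2[of "of_real (cmod (ip f g) + 1)" "ip ((T ^^ n) f) g"] by linarith
  next
    case False
    have ng: "nrm g > 0" using g nrm_zero_imp nrm_nonneg by (metis less_eq_real_def)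
    obtain n where n: "nrm ((T ^^ n) f) < cmod (ip f g) / nrm g"
      using small[of "cmod (ip f g) / nrm g"] False ng by auto
    have "cmod (ip f g) \<le> cmod \<mu> ^ n * cmod (ip f g)"
      using False by (simp add: mult_le_cancel_right1 one_le_power)
    also have "\<dots> = cmod (ip ((T ^^ n) f) g)" by (rule orbit[symmetric])
    also have "\<dots> \<le> nrm ((T ^^ n) f) * nrm g" using TH g(1) by (rule cmod_ip_le)
    also have "\<dots> < cmod (ip f g)" using n ng by (simp add: field_simps)
    finally show False by simp
  qed
qed

lemma not_hypercyclic_if_contraction:
  assumes T: "\<And>f. f \<in> H \<Longrightarrow> T f \<in> H"
    and g: "g \<in> H" "g \<noteq> (\<lambda>x. 0)"
    and contr: "\<And>f. f \<in> H \<Longrightarrow> nrm (T f) \<le> nrm f"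
  shows "\<not> hypercyclic T"
proof
  assume "hypercyclic T"
  then obtain f where f: "f \<in> H" and dense: "\<And>y. \<exists>n. cmod (y - ip ((T ^^ n) f) g) < 1"
    using hypercyclic_orbit_functional g by meson
  have orbit: "(T ^^ n) f \<in> H \<and> nrm ((T ^^ n) f) \<le> nrm f" for n
    by (induction n) (auto intro: f T order_trans[OF contr])
  define B where "B = nrm f * nrm g"
  have B: "B \<ge> 0" unfolding B_def using f g nrm_nonneg by simp
  obtain n where n: "cmod (of_real (B + 1) - ip ((T ^^ n) f) g) < 1" using dense by blast
  have "cmod (ip ((T ^^ n) f) g) \<le> nrm ((T ^^ n) f) * nrm g"
    using orbit g by (intro cmod_ip_le) auto
  also have "\<dots> \<le> B" unfolding B_def using orbit g nrm_nonneg by (intro mult_right_mono) auto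
  finally have "cmod (ip ((T ^^ n) f) g) \<le> B" .
  moreover have "cmod (of_real (B + 1)) = B + 1" using B by (simp only: norm_of_real)
  ultimately show False
    using n norm_triangle_ineq2[of "of_real (B + 1)" "ip ((T ^^ n) f) g"] by linarith
qed

end

section \<open>Orbits of the backward shift\<close>

context de_Branges_Rovnyak_space
begin

text \<open>By \<open>X_adjoint\<close>, both \<open>X\<^sup>* g\<close> and \<open>q\<close> differ from \<open>z g\<close> by multiples of \<open>b\<close>. As \<open>b \<notin> H\<close>, these are
  the same multiple.\<close>

lemma X_adjoint_eqI:
  assumes B: "symbol \<notin> H" and g: "g \<in> H" and q: "q \<in> H"
    and eq: "\<And>z. z \<in> unit_disc \<Longrightarrow> z * g z = q z + d * b z"
    and f: "f \<in> H"
  shows "ip (X f) g = ip f q"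
proof -
  obtain h \<kappa> where h: "h \<in> H" and adj: "ip (X f) g = ip f h"
    and h_eq: "\<And>z. z \<in> unit_disc \<Longrightarrow> h z = z * g z - \<kappa> * b z"
    using X_adjoint[OF g] f by blast
  have diff: "h z - q z = (d - \<kappa>) * symbol z" for z
  proof (cases "z \<in> unit_disc")
    case True
    then show ?thesis using h_eq eq by (simp add: symbol_def algebra_simps)
  next
    case False
    then show ?thesis using supported[OF h] supported[OF q] by (simp add: symbol_def)
  qed
  have "d = \<kappa>"
  proof (rule ccontr)
    assume "d \<noteq> \<kappa>"
    then have "symbol = (\<lambda>z. (1 / (d - \<kappa>)) * (h z - q z))" by (simp add: diff)
    moreover have "(\<lambda>z. (1 / (d - \<kappa>)) * (h z - q z)) \<in> H"
      using h q by (intro scale_mem diff_mem)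
    ultimately show False using B by simp
  qed
  then have "h = q" using diff by auto
  with adj show ?thesis by simp
qed

text \<open>The quotient \<open>g = b / (z - w)\<close> satisfies \<open>z g = w g + b\<close>, so it is an eigenvector of the adjoint.\<close>

lemma not_hypercyclic_if_symbol_has_zero:
  assumes B: "symbol \<notin> H" and w: "w \<in> unit_disc" "b w = 0"
    and nz: "\<exists>z\<in>unit_disc. b z \<noteq> 0"
  shows "\<not> hypercyclic (\<lambda>f z. c * X f z)"
proof -
  obtain g where g: "g \<in> H" and eq: "\<And>z. z \<in> unit_disc \<Longrightarrow> (z - w) * g z = b z - b w"
    using symbol_difference_quotient[OF w(1)] by metis
  have g0: "g \<noteq> (\<lambda>z. 0)"
  proof
    assume "g = (\<lambda>z. 0)"
    then have "\<forall>z\<in>unit_disc. b z = 0" using eq w(2) by simp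
    then show False using nz by blast
  qed
  have "ip (\<lambda>z. c * X f z) g = (c * cnj w) * ip f g" if f: "f \<in> H" for f
  proof -
    have "ip (X f) g = ip f (\<lambda>z. w * g z)"
      using eq w(2) by (intro X_adjoint_eqI[OF B g scale_mem[OF g] _ f, of w 1])
        (simp add: algebra_simps del: mem_ball)
    then show ?thesis using f g by (simp add: ip_scale ip_scale_right X_mem)
  qed
  then show ?thesis
    using g g0 by (intro not_hypercyclic_if_adjoint_eigenvector) (auto intro: scale_mem X_mem)
qed

text \<open>Here \<open>h n\<close> is \<open>(X\<^sup>*)\<^sup>-\<^sup>n f\<close>. As a function it is \<open>b\<close> times the \<open>n\<close>-fold backward shift of \<open>f / b\<close>, so
  one step backwards is \<open>h (n + 1) = X (h n) - d\<^sub>n X b\<close> with the Taylor coefficients \<open>d\<^sub>n\<close> of \<open>f / b\<close>. The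
  norm therefore grows by at most \<open>\<bar>d\<^sub>n\<bar> \<parallel>X b\<parallel>\<close> in each step.\<close>

lemma backward_iterates_bound:
  assumes B: "symbol \<notin> H" and b: "b holomorphic_on unit_disc"
    and nz: "\<And>z. z \<in> unit_disc \<Longrightarrow> b z \<noteq> 0"
    and f: "f \<in> H" and r: "1 < r"
  shows "\<exists>h C. (\<forall>n. h n \<in> H \<and> nrm (h n) \<le> C * r ^ n) \<and> h 0 = f \<and>
    (\<forall>n. \<forall>u\<in>H. ip (X u) (h (Suc n)) = ip u (h n))"
proof -
  define q where "q z = f z / b z" for z
  have hol: "q holomorphic_on unit_disc"
    unfolding q_def using b analytic[OF f] nz by (intro holomorphic_intros) auto
  define d where "d n = (deriv ^^ n) q 0 / fact n" for n
  have q_series: "(\<lambda>n. d n * z ^ n) sums q z" if "z \<in> unit_disc" for z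
    using holomorphic_power_series[OF hol that] by (simp add: d_def)
  define s where "s n z = (\<Sum>k. d (n + k) * z ^ k)" for n z
  have s_series: "(\<lambda>k. d (n + k) * z ^ k) sums s n z" if z: "z \<in> unit_disc" for n z
  proof (cases "z = 0")
    case True
    then show ?thesis
      unfolding s_def using powser_sums_zero[of "\<lambda>k. d (n + k)"] by (simp add: sums_unique[symmetric])
  next
    case False
    have "summable (\<lambda>k. d (k + n) * z ^ (k + n))"
      using q_series[OF z] by (subst summable_iff_shift) (rule sums_summable)
    then have "summable (\<lambda>k. (d (k + n) * z ^ (k + n)) * (1 / z ^ n))" by (rule summable_mult2)
    moreover have "(d (k + n) * z ^ (k + n)) * (1 / z ^ n) = d (n + k) * z ^ k" for k
      using False by (simp add: power_add add.commute)
    ultimately have "summable (\<lambda>k. d (n + k) * z ^ k)" by (simp only:)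
    then show ?thesis unfolding s_def by (rule summable_sums)
  qed
  have s_hol: "s n holomorphic_on unit_disc" for n
    by (rule power_series_holomorphic[where a = "\<lambda>k. d (n + k)"]) (use s_series in simp)
  have s_at_0: "s n 0 = d n" for n
    unfolding s_def using powser_zero[of "\<lambda>k. d (n + k)"] by simp
  have s_Suc: "z * s (Suc n) z = s n z - d n" if z: "z \<in> unit_disc" for n z
  proof -
    have "(\<lambda>k. d (n + Suc k) * z ^ Suc k) sums (z * s (Suc n) z)"
      using sums_mult[OF s_series[OF z, of "Suc n"], of z] by (simp add: mult_ac)
    moreover have "(\<lambda>k. d (n + Suc k) * z ^ Suc k) sums (s n z - d n)"
      using s_series[OF z, of n] sums_Suc_iff[of "\<lambda>k. d (n + k) * z ^ k" "s n z - d n"] by simp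
    ultimately show ?thesis by (rule sums_unique2)
  qed
  define h where "h = rec_nat f (\<lambda>n u z. X u z - d n * X b z)"
  have h_0: "h 0 = f" and h_Suc: "h (Suc n) = (\<lambda>z. X (h n) z - d n * X b z)" for n
    by (simp_all add: h_def)
  have hH: "h n \<in> H" for n
    by (induction n) (auto simp: h_0 h_Suc f intro!: diff_mem scale_mem X_mem X_symbol_mem)
  have h_eq: "\<forall>z\<in>unit_disc. h n z = b z * s n z" for n
  proof (induction n)
    case 0
    have "s 0 z = q z" if "z \<in> unit_disc" for z
      using s_series[OF that, of 0] q_series[OF that] by (simp add: sums_unique2)
    then show ?case using nz by (simp add: h_0 q_def del: mem_ball)
  next
    case (Suc n)
    \<comment> \<open>The factor \<open>z\<close> cannot be cancelled at \<open>0\<close>, so the value there is taken from \<open>backward_shift_eqI\<close>.\<close>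
    define g where "g z = (if z \<in> unit_disc then b z * s (Suc n) z else 0)" for z
    have "X (\<lambda>z. h n z + (- d n) * b z) = g"
    proof (rule backward_shift_eqI)
      have "(\<lambda>z. b z * s (Suc n) z) holomorphic_on unit_disc"
        using b s_hol by (intro holomorphic_intros)
      then show "g holomorphic_on unit_disc"
        by (rule holomorphic_transform) (simp add: g_def)
      show "g z = 0" if "z \<notin> unit_disc" for z using that by (simp add: g_def)
      fix z assume z: "z \<in> unit_disc"
      have "z * g z = b z * (z * s (Suc n) z)" using z by (simp add: g_def)
      also have "\<dots> = b z * s n z - d n * b z" unfolding s_Suc[OF z] by (simp add: algebra_simps)
      also have "\<dots> = h n z - d n * b z" using Suc.IH z by simp
      finally show "z * g z = h n z + - d n * b z - (h n 0 + - d n * b 0)"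
        using Suc.IH s_at_0[of n] by simp
    qed
    moreover have "X (\<lambda>z. h n z + (- d n) * b z) = h (Suc n)"
      using X_add_symbol[OF hH, of n "- d n"] by (simp add: h_Suc)
    ultimately have "h (Suc n) = g" by simp
    then show ?case by (simp add: g_def)
  qed
  have step: "ip (X u) (h (Suc n)) = ip u (h n)" if u: "u \<in> H" for u n
  proof (rule X_adjoint_eqI[OF B hH hH _ u])
    fix z assume z: "z \<in> unit_disc"
    have "z * h (Suc n) z = b z * (z * s (Suc n) z)" using h_eq z by simp
    also have "\<dots> = b z * s n z - d n * b z" unfolding s_Suc[OF z] by (simp add: algebra_simps)
    finally show "z * h (Suc n) z = h n z + (- d n) * b z" using h_eq z by simp
  qed
  have partial: "nrm (h n) \<le> nrm f + nrm (X b) * (\<Sum>k<n. cmod (d k))" for n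
  proof (induction n)
    case (Suc n)
    have "nrm (h (Suc n)) \<le> nrm (X (h n)) + cmod (d n) * nrm (X b)"
      using nrm_diff_triangle[OF X_mem[OF hH[of n]] scale_mem[OF X_symbol_mem], of "d n"]
        nrm_scale[OF X_symbol_mem, of "d n"] by (simp add: h_Suc)
    also have "nrm (X (h n)) \<le> nrm (h n)" by (rule nrm_X_le[OF hH])
    finally show ?case using Suc.IH by (simp add: algebra_simps)
  qed (simp add: h_0)
  \<comment> \<open>Convergence at \<open>x > 1 / r\<close> gives absolute convergence at \<open>1 / r\<close>.\<close>
  obtain x where x: "1 / r < x" "x < 1" using dense[of "1 / r" 1] r by auto
  have x0: "0 < x" using x(1) r by (meson less_trans zero_less_divide_1_iff zero_less_one)
  have "summable (\<lambda>k. d k * of_real x ^ k)"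
    using q_series[of "of_real x"] x x0 by (auto intro: sums_summable)
  then have "summable (\<lambda>k. cmod (d k * of_real (1 / r) ^ k))"
    by (rule powser_insidea) (use x x0 r in \<open>simp only: norm_of_real, simp\<close>)
  then have sm: "summable (\<lambda>k. cmod (d k) * (1 / r) ^ k)"
    using r by (simp add: norm_mult norm_power norm_divide)
  define M where "M = (\<Sum>k. cmod (d k) * (1 / r) ^ k)"
  have bound: "nrm (h n) \<le> (nrm f + nrm (X b) * M) * r ^ n" for n
  proof -
    have "(\<Sum>k<n. cmod (d k)) \<le> (\<Sum>k<n. cmod (d k) * (1 / r) ^ k * r ^ n)"
    proof (rule sum_mono)
      fix k assume "k \<in> {..<n}"
      then have "1 \<le> r ^ (n - k)" using r by (simp add: one_le_power)
      also have "r ^ (n - k) = (1 / r) ^ k * r ^ n"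
        using \<open>k \<in> {..<n}\<close> r by (simp add: power_diff power_one_over field_simps)
      finally show "cmod (d k) \<le> cmod (d k) * (1 / r) ^ k * r ^ n"
        by (metis mult.assoc mult_left_mono mult.right_neutral norm_ge_zero)
    qed
    also have "\<dots> = (\<Sum>k<n. cmod (d k) * (1 / r) ^ k) * r ^ n" by (rule sum_distrib_right[symmetric])
    also have "\<dots> \<le> M * r ^ n"
      unfolding M_def using r sm by (intro mult_right_mono sum_le_suminf) auto
    finally have "nrm (X b) * (\<Sum>k<n. cmod (d k)) \<le> nrm (X b) * (M * r ^ n)"
      by (rule mult_left_mono) (rule nrm_nonneg[OF X_symbol_mem])
    moreover have "nrm f \<le> nrm f * r ^ n"
      using nrm_nonneg[OF f] r by (simp add: mult_le_cancel_left1 one_le_power)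
    ultimately show ?thesis using partial[of n] by (simp add: algebra_simps)
  qed
  from hH bound h_0 step show ?thesis by blast
qed

text \<open>By \<open>\<langle>(c X)\<^sup>n f, h n\<rangle> = c\<^sup>n \<parallel>f\<parallel>\<^sup>2\<close> and the bound on \<open>h n\<close>, an orbit that starts at \<open>f \<noteq> 0\<close> stays away
  from \<open>0\<close>.\<close>

lemma not_hypercyclic_if_symbol_zero_free:
  assumes B: "symbol \<notin> H" and b: "b holomorphic_on unit_disc"
    and nz: "\<And>z. z \<in> unit_disc \<Longrightarrow> b z \<noteq> 0"
    and c: "1 < cmod c" and nontrivial: "\<exists>g\<in>H. g \<noteq> (\<lambda>z. 0)"
  shows "\<not> hypercyclic (\<lambda>f z. c * X f z)"
proof
  let ?T = "\<lambda>f z. c * X f z"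
  assume "hypercyclic ?T"
  then obtain f where f: "f \<in> H" and small: "\<And>\<epsilon>. \<epsilon> > 0 \<Longrightarrow> \<exists>n. nrm ((?T ^^ n) f) < \<epsilon>"
    and dense: "\<And>g y. g \<in> H \<Longrightarrow> g \<noteq> (\<lambda>x. 0) \<Longrightarrow> \<exists>n. cmod (y - ip ((?T ^^ n) f) g) < 1"
    using hypercyclic_orbit_functional[of ?T] by blast
  have TH: "(?T ^^ n) f \<in> H" for n by (induction n) (auto intro: f scale_mem X_mem)
  have nf: "nrm f > 0"
  proof (rule ccontr)
    assume "\<not> nrm f > 0"
    then have "nrm f = 0" using nrm_nonneg[OF f] by simp
    moreover have "nrm ((?T ^^ n) f) \<le> cmod c ^ n * nrm f" for n
    proof (induction n)
      case (Suc n)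
      have "nrm ((?T ^^ Suc n) f) = cmod c * nrm (X ((?T ^^ n) f))"
        using nrm_scale[OF X_mem[OF TH[of n]], of c] by simp
      also have "\<dots> \<le> cmod c * nrm ((?T ^^ n) f)"
        by (intro mult_left_mono nrm_X_le TH) simp
      also have "\<dots> \<le> cmod c * (cmod c ^ n * nrm f)" by (intro mult_left_mono Suc.IH) simp
      finally show ?case by simp
    qed simp
    ultimately have "nrm ((?T ^^ n) f) = 0" for n
      using nrm_nonneg[OF TH[of n]] by (simp add: order_antisym)
    then have zero: "(?T ^^ n) f = (\<lambda>z. 0)" for n using nrm_zero_imp[OF TH] by blast
    obtain g where g: "g \<in> H" "g \<noteq> (\<lambda>z. 0)" using nontrivial by blast
    obtain n where "cmod (1 - ip ((?T ^^ n) f) g) < 1" using dense[OF g] by blast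
    then show False by (simp add: zero ip_zero_left g(1))
  qed
  obtain h C where hH: "\<And>n. h n \<in> H" and bound: "\<And>n. nrm (h n) \<le> C * cmod c ^ n"
    and h0: "h 0 = f" and step: "\<And>n u. u \<in> H \<Longrightarrow> ip (X u) (h (Suc n)) = ip u (h n)"
    using backward_iterates_bound[OF B b nz f c] by blast
  have pair: "ip ((?T ^^ n) f) (h n) = c ^ n * ip f f" for n
  proof (induction n)
    case (Suc n)
    have "ip ((?T ^^ Suc n) f) (h (Suc n)) = c * ip (X ((?T ^^ n) f)) (h (Suc n))"
      using ip_scale[OF X_mem[OF TH[of n]] hH] by simp
    also have "\<dots> = c * (c ^ n * ip f f)" by (simp only: step[OF TH] Suc.IH)
    finally show ?case by simp
  qed (simp add: h0)
  have C: "C > 0" using bound[of 0] nf by (simp add: h0)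
  have lower: "(nrm f)\<^sup>2 / C \<le> nrm ((?T ^^ n) f)" for n
  proof -
    have "cmod c ^ n * (nrm f)\<^sup>2 = cmod (ip ((?T ^^ n) f) (h n))"
      by (simp add: pair ip_self f norm_mult norm_power)
    also have "\<dots> \<le> nrm ((?T ^^ n) f) * nrm (h n)" using TH hH by (rule cmod_ip_le)
    also have "\<dots> \<le> nrm ((?T ^^ n) f) * (C * cmod c ^ n)"
      using bound nrm_nonneg[OF TH] by (rule mult_left_mono)
    finally have "cmod c ^ n * (nrm f)\<^sup>2 \<le> cmod c ^ n * (nrm ((?T ^^ n) f) * C)"
      by (simp add: mult_ac)
    then have "(nrm f)\<^sup>2 \<le> nrm ((?T ^^ n) f) * C"
      by (rule mult_left_le_imp_le) (rule zero_less_power, use c in linarith)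
    then show ?thesis using C by (simp add: pos_divide_le_eq)
  qed
  obtain n where "nrm ((?T ^^ n) f) < (nrm f)\<^sup>2 / C"
    using small[of "(nrm f)\<^sup>2 / C"] nf C by auto
  with lower[of n] show False by linarith
qed

end

theorem theorem4p7:
  fixes b :: "complex \<Rightarrow> complex"
    and H :: "(complex \<Rightarrow> complex) set"
    and ip :: "(complex \<Rightarrow> complex) \<Rightarrow> (complex \<Rightarrow> complex) \<Rightarrow> complex"
  assumes "extreme_in_Hinf_ball b"
    and "\<not> b constant_on unit_disc"
    and "de_Branges_Rovnyak_space b H ip"
  shows "\<forall>c::complex.
    \<not> Metric_space.hypercyclic H (fun_dist H ip) (\<lambda>f z. c * backward_shift f z)"
proof
  fix c :: complex
  interpret de_Branges_Rovnyak_space b H ip by (rule assms(3))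
  have b: "b holomorphic_on unit_disc"
    using assms(1) by (simp add: extreme_in_Hinf_ball_def Hinf_closed_ball_def Hinf_def)
  have nonconst: "\<exists>z\<in>unit_disc. b z \<noteq> y" for y
    using assms(2) by (auto simp: constant_on_def)
  have B: "symbol \<notin> H"
    using pythagorean_mate_if_symbol_mem not_extreme_if_pythagorean_mate[OF assms(1)] by blast
  have Xb: "X b \<noteq> (\<lambda>z. 0)"
  proof
    assume "X b = (\<lambda>z. 0)"
    then have "b z = b 0" if "z \<in> unit_disc" for z
      using mult_backward_shift[OF that, of b] by simp
    then show False using nonconst[of "b 0"] by blast
  qed
  show "\<not> hypercyclic (\<lambda>f z. c * X f z)"
  proof (cases "\<exists>w\<in>unit_disc. b w = 0")
    case True
    then show ?thesis using not_hypercyclic_if_symbol_has_zero[OF B] nonconst by blast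
  next
    case False
    show ?thesis
    proof (cases "cmod c \<le> 1")
      case True
      show ?thesis
      proof (rule not_hypercyclic_if_contraction[OF _ X_symbol_mem Xb])
        fix f assume f: "f \<in> H"
        show "(\<lambda>z. c * X f z) \<in> H" using f by (intro scale_mem X_mem)
        have "nrm (\<lambda>z. c * X f z) = cmod c * nrm (X f)" by (rule nrm_scale[OF X_mem[OF f]])
        also have "\<dots> \<le> nrm (X f)"
          using True nrm_nonneg[OF X_mem[OF f]] by (intro mult_left_le_one_le) auto
        also have "\<dots> \<le> nrm f" by (rule nrm_X_le[OF f])
        finally show "nrm (\<lambda>z. c * X f z) \<le> nrm f" .
      qed
    next
      case c: False
      show ?thesis
        by (rule not_hypercyclic_if_symbol_zero_free[OF B b]) (use False c X_symbol_mem Xb in auto)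
    qed
  qed
qed

end
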